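(* Tubular cluster algebras are of exponential growth. That is, let $Q$ be any one of the four quivers $D_4^{(1,1)}$, $E_6^{(1,1)}$, $E_7^{(1,1)}$, $E_8^{(1,1)}$ described in the context and let $\mathcal{A}$ be a cluster algebra having a seed with exchange quiver $Q$. Then the number of seeds of $\mathcal{A}$ which can be obtained from a fixed initial seed by at most $n$ mutations is bounded from below by an exponentially growing function of $n$.
   Context: Cluster algebras, seeds, quiver mutation and seed mutation are in the sense of Fomin and Zelevinsky (skew-symmetric case); seeds are the vertices of the exchange graph of $\mathcal{A}$, i.e. they are considered up to simultaneous relabelling, and two seeds are joined by an edge if they are related by a single mutation. The (simply laced) tubular cluster algebras are the cluster algebras of tubular types $(2,2,2,2)$, $(3,3,3)$, $(4,4,2)$, $(6,3,2)$; they are the cluster algebras whose exchange quivers are mutation equivalent to one of the following quivers, respectively. $D_4^{(1,1)}$: vertices $b,t,x_1,x_2,x_3,x_4$; two arrows $t\to b$; arrows $b\to x_i$ and $x_i\to t$ for $i=1,2,3,4$. $E_6^{(1,1)}$: vertices $b,t,x,y,z,x',y',z'$; two arrows $t\to b$; arrows $b\to x$, $b\to y$, $b\to z$, $x\to t$, $y\to t$, $z\to t$; and arrows $x'\to x$, $y'\to y$, $z\to z'$. $E_7^{(1,1)}$: vertices $b,t,x,y_1,y_2,y_3,z_1,z_2,z_3$; two arrows $t\to b$; arrows $b\to x\to t$, $b\to y_1\to t$, $b\to z_1\to t$; and arrows $y_3\to y_2\to y_1$ and $z_1\to z_2\to z_3$. $E_8^{(1,1)}$: vertices $b,t,x,y_1,\dots,y_5,z_1,z_2$;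 two arrows $t\to b$; arrows $b\to x\to t$, $b\to y_1\to t$, $b\to z_1\to t$; and arrows $y_5\to y_4\to y_3\to y_2\to y_1$ and $z_1\to z_2$. *)

theory Defs
  imports Complex_Main "HOL-Library.Multiset"
begin

section \<open>Coefficients and the ambient field\<close>

definition is_subring_set :: "'f::ring_1 set \<Rightarrow> bool" where
  "is_subring_set R \<longleftrightarrow> 0 \<in> R \<and> 1 \<in> R \<and>
     (\<forall>a\<in>R. \<forall>b\<in>R. a + b \<in> R \<and> a * b \<in> R \<and> - a \<in> R)"

definition is_subfield_set :: "'f::field set \<Rightarrow> bool" where
  "is_subfield_set K \<longleftrightarrow> is_subring_set K \<and> (\<forall>a\<in>K. inverse a \<in> K)"

text \<open>
  The ambient field is the whole type \<^typ>\<open>'f\<close>. The coefficient semifield is identified with its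
  image in the ambient field: it is a subgroup \<open>P\<close> of the multiplicative group, carrying an
  auxiliary addition \<open>pl\<close> that is unrelated to the addition of the field and whose values
  outside \<open>P\<close> are irrelevant.
\<close>

definition is_semifield :: "'f::field set \<Rightarrow> ('f \<Rightarrow> 'f \<Rightarrow> 'f) \<Rightarrow> bool" where
  "is_semifield P pl \<longleftrightarrow>
     1 \<in> P \<and> 0 \<notin> P \<and> (\<forall>p\<in>P. \<forall>q\<in>P. p * q \<in> P) \<and> (\<forall>p\<in>P. inverse p \<in> P) \<and>
     (\<forall>p\<in>P. \<forall>q\<in>P. pl p q \<in> P \<and> pl p q = pl q p) \<and>
     (\<forall>p\<in>P. \<forall>q\<in>P. \<forall>r\<in>P. pl (pl p q) r = pl p (pl q r) \<and> p * pl q r = pl (p * q) (p * r))"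

text \<open>
  The canonical map from the group ring \<open>\<int>P\<close> to the ambient field is injective; hence the subfield
  generated by \<open>P\<close> is the field of fractions \<open>\<rat>P\<close> of \<open>\<int>P\<close>.
\<close>

definition group_ring_embeds :: "'f::field set \<Rightarrow> bool" where
  "group_ring_embeds P \<longleftrightarrow>
     (\<forall>S (c :: 'f \<Rightarrow> int). finite S \<and> S \<subseteq> P \<and> (\<Sum>p\<in>S. of_int (c p) * p) = 0
        \<longrightarrow> (\<forall>p\<in>S. c p = 0))"

definition coeff_field :: "'f::field set \<Rightarrow> 'f set" where
  "coeff_field P = is_subfield_set hull P"

definition algebraically_independent :: "'f::field set \<Rightarrow> ('v::finite \<Rightarrow> 'f) \<Rightarrow> bool" where
  "algebraically_independent K x \<longleftrightarrow>
     (\<forall>M (c :: ('v \<Rightarrow> nat) \<Rightarrow> 'f).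
        finite M \<and> (\<forall>m\<in>M. c m \<in> K) \<and> (\<Sum>m\<in>M. c m * (\<Prod>i\<in>UNIV. x i ^ m i)) = 0
        \<longrightarrow> (\<forall>m\<in>M. c m = 0))"

text \<open>
  The existence of a free generating set says that the ambient field is isomorphic to the field of
  rational functions over \<open>\<rat>P\<close> in as many variables as there are indices.
\<close>

definition free_generating_set :: "'f::field set \<Rightarrow> ('v::finite \<Rightarrow> 'f) \<Rightarrow> bool" where
  "free_generating_set P x \<longleftrightarrow>
     algebraically_independent (coeff_field P) x \<and>
     is_subfield_set hull (coeff_field P \<union> range x) = UNIV"


section \<open>Seeds and mutations\<close>

record ('v, 'f) labelled_seed =
  cluster :: "'v \<Rightarrow> 'f"
  coefficients :: "'v \<Rightarrow> 'f"
  exchange_matrix :: "'v \<Rightarrow> 'v \<Rightarrow> int"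

definition is_labelled_seed :: "'f::field set \<Rightarrow> ('v::finite, 'f) labelled_seed \<Rightarrow> bool" where
  "is_labelled_seed P s \<longleftrightarrow>
     free_generating_set P (cluster s) \<and> range (coefficients s) \<subseteq> P \<and>
     (\<forall>i j. exchange_matrix s i j = - exchange_matrix s j i)"

definition mutate_matrix :: "'v \<Rightarrow> ('v \<Rightarrow> 'v \<Rightarrow> int) \<Rightarrow> 'v \<Rightarrow> 'v \<Rightarrow> int" where
  "mutate_matrix k b i j =
     (if i = k \<or> j = k then - b i j else b i j + sgn (b i k) * max 0 (b i k * b k j))"

text \<open>
  In the exponents, \<open>nat b\<close> is the positive part \<open>max b 0\<close> of the integer \<open>b\<close>.
\<close>

definition mutate_coefficients ::
  "('f \<Rightarrow> 'f \<Rightarrow> 'f) \<Rightarrow> 'v \<Rightarrow> ('v \<Rightarrow> 'v \<Rightarrow> int) \<Rightarrow> ('v \<Rightarrow> 'f::field) \<Rightarrow> 'v \<Rightarrow> 'f" where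
  "mutate_coefficients pl k b y j =
     (if j = k then inverse (y k)
      else y j * y k ^ nat (b k j) * (pl (y k) 1 powi (- b k j)))"

definition mutate_cluster ::
  "('f \<Rightarrow> 'f \<Rightarrow> 'f) \<Rightarrow> 'v::finite \<Rightarrow> ('v, 'f::field) labelled_seed \<Rightarrow> 'v \<Rightarrow> 'f" where
  "mutate_cluster pl k s =
     (let x = cluster s; y = coefficients s; b = exchange_matrix s in
      x(k := (y k * (\<Prod>i\<in>UNIV. x i ^ nat (b i k)) + (\<Prod>i\<in>UNIV. x i ^ nat (- b i k)))
             / (pl (y k) 1 * x k)))"

definition mutate ::
  "('f \<Rightarrow> 'f \<Rightarrow> 'f) \<Rightarrow> 'v::finite \<Rightarrow> ('v, 'f::field) labelled_seed \<Rightarrow> ('v, 'f) labelled_seed" where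
  "mutate pl k s =
     \<lparr> cluster = mutate_cluster pl k s,
       coefficients = mutate_coefficients pl k (exchange_matrix s) (coefficients s),
       exchange_matrix = mutate_matrix k (exchange_matrix s) \<rparr>"

definition relabel :: "('v \<Rightarrow> 'v) \<Rightarrow> ('v, 'f) labelled_seed \<Rightarrow> ('v, 'f) labelled_seed" where
  "relabel \<sigma> s =
     \<lparr> cluster = (\<lambda>i. cluster s (\<sigma> i)),
       coefficients = (\<lambda>i. coefficients s (\<sigma> i)),
       exchange_matrix = (\<lambda>i j. exchange_matrix s (\<sigma> i) (\<sigma> j)) \<rparr>"

text \<open>
  A seed (up to simultaneous relabelling) is an equivalence class of labelled seeds.
\<close>

type_synonym ('v, 'f) seed = "('v, 'f) labelled_seed set"

definition seed_of :: "('v, 'f) labelled_seed \<Rightarrow> ('v, 'f) seed" where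
  "seed_of s = {relabel \<sigma> s | \<sigma>. bij \<sigma>}"

definition exchange_edges ::
  "('f \<Rightarrow> 'f \<Rightarrow> 'f) \<Rightarrow> (('v::finite, 'f::field) seed \<times> ('v, 'f) seed) set" where
  "exchange_edges pl = {(S, T). \<exists>s\<in>S. \<exists>k. T = seed_of (mutate pl k s)}"

definition seeds_within ::
  "('f \<Rightarrow> 'f \<Rightarrow> 'f) \<Rightarrow> ('v::finite, 'f::field) seed \<Rightarrow> nat \<Rightarrow> ('v, 'f) seed set" where
  "seeds_within pl S n = {T. \<exists>m\<le>n. (S, T) \<in> exchange_edges pl ^^ m}"


section \<open>Cluster algebras\<close>

text \<open>
  A cluster algebra is considered together with its underlying set of seeds. As \<open>P\<close> is closed
  under inverses, the \<open>\<int>P\<close>-subalgebra generated by the cluster variables is the subring generated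
  by \<open>P\<close> and the cluster variables.
\<close>

record ('v, 'f) cluster_algebra =
  seeds :: "('v, 'f) seed set"
  algebra_carrier :: "'f set"

definition is_cluster_algebra ::
  "'f::field_char_0 set \<Rightarrow> ('f \<Rightarrow> 'f \<Rightarrow> 'f) \<Rightarrow> ('v::finite, 'f) cluster_algebra \<Rightarrow> bool" where
  "is_cluster_algebra P pl A \<longleftrightarrow>
     is_semifield P pl \<and> group_ring_embeds P \<and>
     (\<exists>s. is_labelled_seed P s \<and> seeds A = {T. (seed_of s, T) \<in> (exchange_edges pl)\<^sup>*}) \<and>
     algebra_carrier A =
       is_subring_set hull (P \<union> (\<Union>S\<in>seeds A. \<Union>s\<in>S. range (cluster s)))"


section \<open>Quivers\<close>

record 'a quiver =
  vertices :: "'a set"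
  arrows :: "('a \<times> 'a) multiset"

text \<open>
  A positive entry \<open>b i j\<close> of the exchange matrix stands for \<open>b i j\<close> arrows from \<open>i\<close> to \<open>j\<close>.
\<close>

definition has_exchange_quiver :: "('v, 'f) labelled_seed \<Rightarrow> 'a quiver \<Rightarrow> bool" where
  "has_exchange_quiver s Q \<longleftrightarrow>
     (\<exists>\<phi>. bij_betw \<phi> UNIV (vertices Q) \<and>
        (\<forall>i j. exchange_matrix s i j =
           int (count (arrows Q) (\<phi> i, \<phi> j)) - int (count (arrows Q) (\<phi> j, \<phi> i))))"

datatype vertex = Vb | Vt | Vx nat | Vy nat | Vz nat

definition D4_11 :: "vertex quiver" where
  "D4_11 =
     \<lparr> vertices = {Vb, Vt, Vx 1, Vx 2, Vx 3, Vx 4},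
       arrows = {# (Vt, Vb), (Vt, Vb),
                   (Vb, Vx 1), (Vb, Vx 2), (Vb, Vx 3), (Vb, Vx 4),
                   (Vx 1, Vt), (Vx 2, Vt), (Vx 3, Vt), (Vx 4, Vt) #} \<rparr>"

text \<open>
  Here the primed vertices \<open>x', y', z'\<close> are \<open>Vx 2\<close>, \<open>Vy 2\<close>, \<open>Vz 2\<close>.
\<close>

definition E6_11 :: "vertex quiver" where
  "E6_11 =
     \<lparr> vertices = {Vb, Vt, Vx 1, Vy 1, Vz 1, Vx 2, Vy 2, Vz 2},
       arrows = {# (Vt, Vb), (Vt, Vb),
                   (Vb, Vx 1), (Vb, Vy 1), (Vb, Vz 1),
                   (Vx 1, Vt), (Vy 1, Vt), (Vz 1, Vt),
                   (Vx 2, Vx 1), (Vy 2, Vy 1), (Vz 1, Vz 2) #} \<rparr>"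

definition E7_11 :: "vertex quiver" where
  "E7_11 =
     \<lparr> vertices = {Vb, Vt, Vx 1, Vy 1, Vy 2, Vy 3, Vz 1, Vz 2, Vz 3},
       arrows = {# (Vt, Vb), (Vt, Vb),
                   (Vb, Vx 1), (Vx 1, Vt), (Vb, Vy 1), (Vy 1, Vt), (Vb, Vz 1), (Vz 1, Vt),
                   (Vy 3, Vy 2), (Vy 2, Vy 1),
                   (Vz 1, Vz 2), (Vz 2, Vz 3) #} \<rparr>"

definition E8_11 :: "vertex quiver" where
  "E8_11 =
     \<lparr> vertices = {Vb, Vt, Vx 1, Vy 1, Vy 2, Vy 3, Vy 4, Vy 5, Vz 1, Vz 2},
       arrows = {# (Vt, Vb), (Vt, Vb),
                   (Vb, Vx 1), (Vx 1, Vt), (Vb, Vy 1), (Vy 1, Vt), (Vb, Vz 1), (Vz 1, Vt),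
                   (Vy 5, Vy 4), (Vy 4, Vy 3), (Vy 3, Vy 2), (Vy 2, Vy 1),
                   (Vz 1, Vz 2) #} \<rparr>"

end

theory Submission
  imports Defs
begin

text \<open>
  Assign a real weight to every variable of one cluster and weight 0 to every coefficient. As all
  exchange relations are subtraction free, no leading terms cancel, and the weights extend to a
  tropical valuation \<open>w\<close>: a product goes to the sum and a sum goes to the maximum
  (\<open>tropical_valuation_exists\<close>). On clusters, a mutation then becomes the piecewise linear map
  \<open>u\<^sub>k \<mapsto> max (\<Sum>[b\<^sub>i\<^sub>k]\<^sub>+ u\<^sub>i, \<Sum>[-b\<^sub>i\<^sub>k]\<^sub>+ u\<^sub>i) - u\<^sub>k\<close>, in which the coefficients have
  disappeared. It is an involution, so the weights may be prescribed at any seed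
  (\<open>tropical_values_prescribed\<close>).

  The key is a plane of weights on which everything is linear. In the weighted projective line of
  the given tubular type, \<open>t\<close> and \<open>b\<close> are line bundles, the arm vertices are torsion sheaves in the
  exceptional tubes, and for a fixed direction \<open>\<zeta>\<close> the function \<open>X \<mapsto> \<bar>det (\<zeta>, (rk X, deg X))\<bar>\<close>
  serves as a weight. If \<open>\<zeta>\<close> lies between the classes of \<open>t\<close> and \<open>b\<close>, this gives \<open>b\<close> the weight
  \<open>\<rho>\<beta>\<close>, \<open>t\<close> the weight \<open>\<rho>\<tau>\<close> and an arm vertex a fixed multiple of \<open>\<beta> + \<tau>\<close>, where \<open>\<beta>, \<tau> > 0\<close> and
  \<open>\<rho>\<close> is the least common multiple of the tubular type. For each of the four quivers there are two
  words of mutations, of equal length, that lead back to the same quiver and to weights of the same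
  shape; the parameters \<open>(\<beta>, \<tau>)\<close> are transformed by two invertible nonnegative matrices. Along
  these words every maximum is attained by the same term for all \<open>\<beta>, \<tau> > 0\<close>, so it is enough to
  mutate linear forms in \<open>\<beta>\<close> and \<open>\<tau>\<close>. The words are thus finite certificates, and they can be
  checked by rewriting (\<open>D4_certificate\<close> to \<open>E8_certificate\<close>).

  The two matrices map the open quadrant into itself with disjoint images. By ping-pong, the \<open>2\<^sup>m\<close>
  products of \<open>m\<close> of them send \<open>(1, 1)\<close> to \<open>2\<^sup>m\<close> different points (\<open>ping_pong_level_card\<close>). The point
  \<open>(\<beta>, \<tau>)\<close> depends only on the seed up to relabelling, since \<open>t\<close> and \<open>b\<close> are the ends of the only
  double arrow (\<open>standard_seed_parameter_unique\<close>). So \<open>2\<^sup>m\<close> different seeds lie within distance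
  \<open>m L\<close>, where \<open>L\<close> is the length of the words. As mutation is involutive, every seed of the algebra
  has a finite distance to the seed with quiver \<open>Q\<close>; a change of the initial seed affects only the
  constant.
\<close>

section \<open>Tropical valuations\<close>

text \<open>
  The finite nonempty sums of elements of \<open>P\<close>, that is, the nonzero elements of the semiring \<open>\<nat>P\<close>.
\<close>

definition positive_elements :: "'f::field set \<Rightarrow> 'f set" where
  "positive_elements P = {sum_mset X | X. X \<noteq> {#} \<and> set_mset X \<subseteq> P}"

definition monomial_value :: "('v::finite \<Rightarrow> 'f::field) \<Rightarrow> ('v \<Rightarrow> nat) \<Rightarrow> 'f" where
  "monomial_value x m = (\<Prod>i\<in>UNIV. x i ^ m i)"

text \<open>
  The set \<open>M\<close> of exponents is exactly the support, as the coefficients are nonzero elements of \<open>\<nat>P\<close>.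
\<close>

definition positive_polynomial ::
  "'f::field set \<Rightarrow> ('v::finite \<Rightarrow> 'f) \<Rightarrow> ('v \<Rightarrow> nat) set \<Rightarrow> 'f \<Rightarrow> bool" where
  "positive_polynomial P x M f \<longleftrightarrow> finite M \<and> M \<noteq> {} \<and>
     (\<exists>c. (\<forall>m\<in>M. c m \<in> positive_elements P) \<and> f = (\<Sum>m\<in>M. c m * monomial_value x m))"

definition weighted_degree :: "('v::finite \<Rightarrow> real) \<Rightarrow> ('v \<Rightarrow> nat) set \<Rightarrow> real" where
  "weighted_degree v M = Max ((\<lambda>m. \<Sum>i\<in>UNIV. real (m i) * v i) ` M)"

definition minkowski_sum :: "('v \<Rightarrow> nat) set \<Rightarrow> ('v \<Rightarrow> nat) set \<Rightarrow> ('v \<Rightarrow> nat) set" where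
  "minkowski_sum M N = (\<lambda>(m, n) i. m i + n i) ` (M \<times> N)"

text \<open>
  A homomorphism from the positive part \<open>D\<close> of the field to the max-plus semifield that is trivial
  on the coefficients. The set \<open>D\<close> has to be part of the data: a sum of elements of \<open>D\<close> has the larger
  of the two values even when both values agree, which no valuation of the whole field can achieve.
\<close>

definition tropical_valuation :: "'f::field set \<Rightarrow> 'f set \<Rightarrow> ('f \<Rightarrow> real) \<Rightarrow> bool" where
  "tropical_valuation P D w \<longleftrightarrow> 0 \<notin> D \<and> P \<subseteq> D \<and> (\<forall>p\<in>P. w p = 0) \<and>
     (\<forall>f\<in>D. inverse f \<in> D \<and> w (inverse f) = - w f) \<and>
     (\<forall>f\<in>D. \<forall>g\<in>D. f * g \<in> D \<and> w (f * g) = w f + w g \<and>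
        f + g \<in> D \<and> w (f + g) = max (w f) (w g))"

lemma sum_mset_eq_sum_count:
  "sum_mset X = (\<Sum>p\<in>set_mset X. of_int (int (count X p)) * (p::'f::field))"
proof (induction X)
  case (add q X)
  have "(\<Sum>p\<in>set_mset (add_mset q X). of_int (int (count (add_mset q X) p)) * p)
      = (\<Sum>p\<in>insert q (set_mset X). of_nat (count X p) * p + (if p = q then p else 0))"
    by (intro sum.cong) (auto simp: distrib_right)
  also have "\<dots> = (\<Sum>p\<in>insert q (set_mset X). of_nat (count X p) * p) + q"
    by (simp add: sum.distrib)
  also have "(\<Sum>p\<in>insert q (set_mset X). of_nat (count X p) * p) = (\<Sum>p\<in>set_mset X. of_nat (count X p) * p)"
    by (intro sum.mono_neutral_right) (auto simp: not_in_iff)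
  finally show ?case using add.IH by simp
qed simp

text \<open>
  Positivity survives in the field because the group ring \<open>\<int>P\<close> embeds: a sum of elements of \<open>P\<close> is
  the image of a group ring element with positive coefficients.
\<close>

lemma positive_elements_nonzero:
  assumes "group_ring_embeds P"
  shows "0 \<notin> positive_elements P"
proof
  assume "0 \<in> positive_elements P"
  then obtain X where X: "sum_mset X = 0" "X \<noteq> {#}" "set_mset X \<subseteq> P"
    unfolding positive_elements_def by force
  then have "\<forall>p\<in>set_mset X. int (count X p) = 0"
    using assms sum_mset_eq_sum_count[of X] unfolding group_ring_embeds_def
    by (metis finite_set_mset)
  with X show False
    by (metis count_eq_zero_iff multiset_nonemptyE of_nat_eq_0_iff)
qed

lemma positive_elements_base: "p \<in> P \<Longrightarrow> p \<in> positive_elements P"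
  unfolding positive_elements_def by (auto intro!: exI[of _ "{#p#}"])

lemma positive_elements_add:
  assumes "f \<in> positive_elements P" "g \<in> positive_elements P"
  shows "f + g \<in> positive_elements P"
proof -
  obtain X Y where "f = sum_mset X" "X \<noteq> {#}" "set_mset X \<subseteq> P"
    "g = sum_mset Y" "set_mset Y \<subseteq> P"
    using assms unfolding positive_elements_def by auto
  then show ?thesis
    unfolding positive_elements_def by (auto intro!: exI[of _ "X + Y"])
qed

lemma positive_elements_mult:
  assumes P: "\<And>p q. p \<in> P \<Longrightarrow> q \<in> P \<Longrightarrow> p * q \<in> P"
    and "f \<in> positive_elements P" "g \<in> positive_elements P"
  shows "f * g \<in> positive_elements P"
proof -
  obtain X Y where X: "f = sum_mset X" "X \<noteq> {#}" "set_mset X \<subseteq> P"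
    and Y: "g = sum_mset Y" "Y \<noteq> {#}" "set_mset Y \<subseteq> P"
    using assms unfolding positive_elements_def by auto
  have scaled: "p * sum_mset Y \<in> positive_elements P" if "p \<in> P" for p
  proof -
    have "p * sum_mset Y = sum_mset (image_mset ((*) p) Y)"
      using sum_mset_distrib_left[of p "\<lambda>y. y" Y] by simp
    moreover have "image_mset ((*) p) Y \<noteq> {#}" "set_mset (image_mset ((*) p) Y) \<subseteq> P"
      using that Y P by auto
    ultimately show ?thesis unfolding positive_elements_def by blast
  qed
  have "X \<noteq> {#} \<Longrightarrow> set_mset X \<subseteq> P \<Longrightarrow> sum_mset X * sum_mset Y \<in> positive_elements P"
  proof (induction X)
    case (add p X)
    show ?case
    proof (cases "X = {#}")
      case True
      then show ?thesis using add.prems scaled[of p] by simp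
    next
      case False
      then show ?thesis using add scaled[of p] positive_elements_add
        by (simp add: distrib_right)
    qed
  qed simp
  with X Y show ?thesis by simp
qed

lemma positive_elements_sum:
  assumes "finite S" "S \<noteq> {}" "\<And>s. s \<in> S \<Longrightarrow> h s \<in> positive_elements P"
  shows "(\<Sum>s\<in>S. h s) \<in> positive_elements P"
  using assms by (induction S rule: finite_ne_induct) (auto intro: positive_elements_add)

lemma is_subfield_set_Inter:
  assumes "\<And>K. K \<in> \<K> \<Longrightarrow> is_subfield_set K"
  shows "is_subfield_set (\<Inter>\<K>)"
  using assms unfolding is_subfield_set_def is_subring_set_def by blast

lemma coeff_field_subfield: "is_subfield_set (coeff_field P)"
  unfolding coeff_field_def hull_def by (rule is_subfield_set_Inter) simp

lemma positive_elements_subset_coeff_field: "positive_elements P \<subseteq> coeff_field P"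
proof
  fix f assume "f \<in> positive_elements P"
  then obtain X where X: "f = sum_mset X" "set_mset X \<subseteq> P"
    unfolding positive_elements_def by auto
  have "P \<subseteq> coeff_field P" unfolding coeff_field_def by (rule hull_subset)
  moreover have "set_mset X \<subseteq> coeff_field P \<Longrightarrow> sum_mset X \<in> coeff_field P"
    using coeff_field_subfield[of P] unfolding is_subfield_set_def is_subring_set_def
    by (induction X) auto
  ultimately show "f \<in> coeff_field P" using X by auto
qed

lemma positive_polynomialI:
  assumes "finite M" "M \<noteq> {}" "\<And>m. m \<in> M \<Longrightarrow> c m \<in> positive_elements P"
    "f = (\<Sum>m\<in>M. c m * monomial_value x m)"
  shows "positive_polynomial P x M f"
  using assms unfolding positive_polynomial_def by blast

lemma positive_polynomialE:
  assumes "positive_polynomial P x M f"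
  obtains c where "finite M" "M \<noteq> {}" "\<forall>m\<in>M. c m \<in> positive_elements P"
    "f = (\<Sum>m\<in>M. c m * monomial_value x m)"
  using assms unfolding positive_polynomial_def by blast

lemma algebraically_independentD:
  assumes "algebraically_independent K x" "finite M" "\<And>m. m \<in> M \<Longrightarrow> c m \<in> K"
    "(\<Sum>m\<in>M. c m * monomial_value x m) = 0"
  shows "\<forall>m\<in>M. c m = 0"
  using assms unfolding algebraically_independent_def monomial_value_def by blast

text \<open>
  The difference of two representations of \<open>f\<close> is a relation among monomials with coefficients in
  \<open>\<rat>P\<close>, so algebraic independence forces the coefficients, and with them the supports, to agree.
\<close>

lemma positive_polynomial_support_unique:
  assumes emb: "group_ring_embeds P"
    and ind: "algebraically_independent (coeff_field P) x"
    and M: "positive_polynomial P x M f" and N: "positive_polynomial P x N f"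
  shows "M = N"
proof -
  obtain c where c: "\<forall>m\<in>M. c m \<in> positive_elements P" "f = (\<Sum>m\<in>M. c m * monomial_value x m)"
    and finM: "finite M" "M \<noteq> {}"
    using M by (rule positive_polynomialE)
  obtain d where d: "\<forall>m\<in>N. d m \<in> positive_elements P" "f = (\<Sum>m\<in>N. d m * monomial_value x m)"
    and finN: "finite N" "N \<noteq> {}"
    using N by (rule positive_polynomialE)
  note fin = finM finN
  define h where "h m = (if m \<in> M then c m else 0) - (if m \<in> N then d m else 0)" for m
  have K: "0 \<in> coeff_field P" "\<And>a b. a \<in> coeff_field P \<Longrightarrow> b \<in> coeff_field P \<Longrightarrow> a - b \<in> coeff_field P"
    using coeff_field_subfield[of P] unfolding is_subfield_set_def is_subring_set_def
    by (auto simp: diff_conv_add_uminus simp del: add_uminus_conv_diff)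
  have cd: "c m \<in> coeff_field P" if "m \<in> M" for m
    using c that positive_elements_subset_coeff_field by auto
  have dd: "d m \<in> coeff_field P" if "m \<in> N" for m
    using d that positive_elements_subset_coeff_field by auto
  have inK: "\<forall>m\<in>M \<union> N. h m \<in> coeff_field P"
    unfolding h_def using K(1) cd dd by (intro ballI K(2)) auto
  have "(\<Sum>m\<in>M \<union> N. h m * monomial_value x m) =
      (\<Sum>m\<in>M \<union> N. (if m \<in> M then c m else 0) * monomial_value x m)
      - (\<Sum>m\<in>M \<union> N. (if m \<in> N then d m else 0) * monomial_value x m)"
    unfolding h_def by (simp add: left_diff_distrib sum_subtractf)
  also have "(\<Sum>m\<in>M \<union> N. (if m \<in> M then c m else 0) * monomial_value x m) = f"
    unfolding c(2) using fin by (intro sum.mono_neutral_cong_right) auto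
  also have "(\<Sum>m\<in>M \<union> N. (if m \<in> N then d m else 0) * monomial_value x m) = f"
    unfolding d(2) using fin by (intro sum.mono_neutral_cong_right) auto
  finally have "(\<Sum>m\<in>M \<union> N. h m * monomial_value x m) = 0" by simp
  then have "\<forall>m\<in>M \<union> N. h m = 0"
    using inK fin by (intro algebraically_independentD[OF ind]) auto
  moreover have "0 \<notin> positive_elements P" using emb by (rule positive_elements_nonzero)
  ultimately show "M = N"
    unfolding h_def using c(1) d(1)
    by (auto split: if_splits) force+
qed

lemma positive_polynomial_nonzero:
  assumes emb: "group_ring_embeds P"
    and ind: "algebraically_independent (coeff_field P) x"
    and M: "positive_polynomial P x M f"
  shows "f \<noteq> 0"
proof
  assume "f = 0"
  obtain c where c: "\<forall>m\<in>M. c m \<in> positive_elements P" "f = (\<Sum>m\<in>M. c m * monomial_value x m)"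
    and fin: "finite M" "M \<noteq> {}"
    using M by (rule positive_polynomialE)
  have zero: "\<forall>m\<in>M. c m = 0"
  proof (rule algebraically_independentD[OF ind fin(1)])
    show "c m \<in> coeff_field P" if "m \<in> M" for m
      using that c(1) positive_elements_subset_coeff_field by blast
    show "(\<Sum>m\<in>M. c m * monomial_value x m) = 0" using c(2) \<open>f = 0\<close> by simp
  qed
  obtain m where "m \<in> M" using fin(2) by blast
  then have "0 \<in> positive_elements P" using c(1) zero by metis
  with positive_elements_nonzero[OF emb] show False by contradiction
qed

lemma positive_polynomial_add:
  assumes M: "positive_polynomial P x M f" and N: "positive_polynomial P x N g"
  shows "positive_polynomial P x (M \<union> N) (f + g)"
proof -
  obtain c where c: "\<forall>m\<in>M. c m \<in> positive_elements P" "f = (\<Sum>m\<in>M. c m * monomial_value x m)"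
    and finM: "finite M" "M \<noteq> {}"
    using M by (rule positive_polynomialE)
  obtain d where d: "\<forall>m\<in>N. d m \<in> positive_elements P" "g = (\<Sum>m\<in>N. d m * monomial_value x m)"
    and finN: "finite N" "N \<noteq> {}"
    using N by (rule positive_polynomialE)
  note fin = finM finN
  define h where "h m = (if m \<in> M then c m else 0) + (if m \<in> N then d m else 0)" for m
  have "(\<Sum>m\<in>M \<union> N. h m * monomial_value x m) =
      (\<Sum>m\<in>M \<union> N. (if m \<in> M then c m else 0) * monomial_value x m)
      + (\<Sum>m\<in>M \<union> N. (if m \<in> N then d m else 0) * monomial_value x m)"
    unfolding h_def by (simp add: distrib_right sum.distrib)
  also have "(\<Sum>m\<in>M \<union> N. (if m \<in> M then c m else 0) * monomial_value x m) = f"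
    unfolding c(2) using fin by (intro sum.mono_neutral_cong_right) auto
  also have "(\<Sum>m\<in>M \<union> N. (if m \<in> N then d m else 0) * monomial_value x m) = g"
    unfolding d(2) using fin by (intro sum.mono_neutral_cong_right) auto
  finally have "f + g = (\<Sum>m\<in>M \<union> N. h m * monomial_value x m)" by simp
  moreover have "h m \<in> positive_elements P" if "m \<in> M \<union> N" for m
    using that c(1) d(1) by (auto simp: h_def intro: positive_elements_add)
  ultimately show ?thesis
    using fin by (intro positive_polynomialI[where c = h]) auto
qed

text \<open>
  Different pairs of exponents may have the same sum, but the coefficients collected there are
  positive and do not cancel. So the support of the product is the full Minkowski sum.
\<close>

lemma positive_polynomial_mult:
  assumes P: "\<And>p q. p \<in> P \<Longrightarrow> q \<in> P \<Longrightarrow> p * q \<in> P"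
    and M: "positive_polynomial P x M f" and N: "positive_polynomial P x N g"
  shows "positive_polynomial P x (minkowski_sum M N) (f * g)"
proof -
  obtain c where c: "\<forall>m\<in>M. c m \<in> positive_elements P" "f = (\<Sum>m\<in>M. c m * monomial_value x m)"
    and finM: "finite M" "M \<noteq> {}"
    using M by (rule positive_polynomialE)
  obtain d where d: "\<forall>m\<in>N. d m \<in> positive_elements P" "g = (\<Sum>m\<in>N. d m * monomial_value x m)"
    and finN: "finite N" "N \<noteq> {}"
    using N by (rule positive_polynomialE)
  note fin = finM finN
  let ?plus = "\<lambda>(m, n) i. m i + n i :: nat"
  \<comment> \<open>The coefficient of the product at the exponent \<open>k\<close>.\<close>
  define h where "h k = (\<Sum>(m, n)\<in>{mn \<in> M \<times> N. ?plus mn = k}. c m * d n)" for k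
  have "f * g = (\<Sum>(m, n)\<in>M \<times> N. c m * d n * monomial_value x (?plus (m, n)))"
    unfolding c(2) d(2) monomial_value_def
    by (simp add: sum_product sum.cartesian_product power_add prod.distrib mult_ac)
  also have "\<dots> = (\<Sum>k\<in>minkowski_sum M N.
      \<Sum>mn\<in>{mn \<in> M \<times> N. ?plus mn = k}. case mn of (m, n) \<Rightarrow> c m * d n * monomial_value x (?plus (m, n)))"
    unfolding minkowski_sum_def using fin by (intro sum.image_gen) auto
  also have "\<dots> = (\<Sum>k\<in>minkowski_sum M N. h k * monomial_value x k)"
    unfolding h_def sum_distrib_right by (intro sum.cong) auto
  finally have "f * g = (\<Sum>k\<in>minkowski_sum M N. h k * monomial_value x k)" .
  moreover have "h k \<in> positive_elements P" if k: "k \<in> minkowski_sum M N" for k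
    unfolding h_def
  proof (rule positive_elements_sum)
    show "finite {mn \<in> M \<times> N. ?plus mn = k}" using fin by auto
    show "{mn \<in> M \<times> N. ?plus mn = k} \<noteq> {}" using k unfolding minkowski_sum_def by auto
    show "(case mn of (m, n) \<Rightarrow> c m * d n) \<in> positive_elements P"
      if "mn \<in> {mn \<in> M \<times> N. ?plus mn = k}" for mn
      using that c d P by (auto intro: positive_elements_mult)
  qed
  ultimately show ?thesis
    using fin by (intro positive_polynomialI[where c = h]) (auto simp: minkowski_sum_def)
qed

lemma weighted_degree_union:
  assumes "finite M" "finite N" "M \<noteq> {}" "N \<noteq> {}"
  shows "weighted_degree v (M \<union> N) = max (weighted_degree v M) (weighted_degree v N)"
  unfolding weighted_degree_def image_Un using assms by (intro Max_Un) auto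

text \<open>
  A linear functional attains its maximum on a Minkowski sum at the sum of two maximisers.
\<close>

lemma weighted_degree_minkowski_sum:
  assumes "finite M" "finite N" "M \<noteq> {}" "N \<noteq> {}"
  shows "weighted_degree v (minkowski_sum M N) = weighted_degree v M + weighted_degree v N"
proof -
  let ?l = "\<lambda>m. \<Sum>i\<in>UNIV. real (m i) * v i"
  have add: "?l (\<lambda>i. m i + n i) = ?l m + ?l n" for m n
    by (simp add: distrib_right sum.distrib)
  have attained: "\<exists>m\<in>L. weighted_degree v L = ?l m" if "finite L" "L \<noteq> {}" for L
  proof -
    have "Max (?l ` L) \<in> ?l ` L" using that by (intro Max_in) auto
    then show ?thesis unfolding weighted_degree_def by auto
  qed
  obtain m0 where m0: "m0 \<in> M" "weighted_degree v M = ?l m0"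
    using attained[OF assms(1,3)] by blast
  obtain n0 where n0: "n0 \<in> N" "weighted_degree v N = ?l n0"
    using attained[OF assms(2,4)] by blast
  have bound: "?l m \<le> weighted_degree v L" if "finite L" "m \<in> L" for m L
    unfolding weighted_degree_def using that by (intro Max_ge) auto
  have le: "?l m \<le> ?l m0" "?l n \<le> ?l n0" if "m \<in> M" "n \<in> N" for m n
    using bound[OF assms(1) that(1)] bound[OF assms(2) that(2)] m0(2) n0(2) by simp_all
  show ?thesis
    unfolding m0(2) n0(2) unfolding weighted_degree_def
  proof (rule Max_eqI)
    show "finite (?l ` minkowski_sum M N)" unfolding minkowski_sum_def using assms by auto
    show "?l m0 + ?l n0 \<in> ?l ` minkowski_sum M N"
      using m0(1) n0(1) add[of m0 n0] unfolding minkowski_sum_def image_image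
      by (intro image_eqI[of _ _ "(m0, n0)"]) auto
    show "y \<le> ?l m0 + ?l n0" if "y \<in> ?l ` minkowski_sum M N" for y
    proof -
      obtain k where k: "k \<in> minkowski_sum M N" "y = ?l k"
        using \<open>y \<in> ?l ` minkowski_sum M N\<close> by (rule imageE)
      obtain m n where mn: "m \<in> M" "n \<in> N" "k = (\<lambda>i. m i + n i)"
        using k(1) unfolding minkowski_sum_def by auto
      show ?thesis unfolding k(2) mn(3) add using le[OF mn(1,2)] by (rule add_mono)
    qed
  qed
qed

text \<open>
  On a quotient \<open>g / h\<close> of positive polynomials the valuation is the difference of the weighted
  degrees. It is well defined: if \<open>g / h = g' / h'\<close>, then \<open>g h'\<close> and \<open>g' h\<close> have the same support,
  and the weighted degree of a product is the sum of the weighted degrees.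
\<close>

lemma tropical_valuation_exists:
  fixes x :: "'v::finite \<Rightarrow> 'f::field"
  assumes sf: "is_semifield P pl" and emb: "group_ring_embeds P"
    and ind: "algebraically_independent (coeff_field P) x"
  shows "\<exists>D w. tropical_valuation P D w \<and> (\<forall>i. x i \<in> D \<and> w (x i) = v i)"
proof -
  let ?pp = "positive_polynomial P x"
  define V where "V f d \<longleftrightarrow> (\<exists>g h M N. ?pp M g \<and> ?pp N h \<and> f * h = g \<and>
      d = weighted_degree v M - weighted_degree v N)" for f d
  have mulP: "\<And>p q. p \<in> P \<Longrightarrow> q \<in> P \<Longrightarrow> p * q \<in> P" and oneP: "1 \<in> P"
    using sf unfolding is_semifield_def by auto
  note nz = positive_polynomial_nonzero[OF emb ind]
  have mul: "?pp (minkowski_sum M N) (g * h)" if "?pp M g" "?pp N h" for M N g h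
    by (rule positive_polynomial_mult[OF _ that]) (rule mulP)
  have fin: "?pp M g \<Longrightarrow> finite M" "?pp M g \<Longrightarrow> M \<noteq> {}" for M g
    unfolding positive_polynomial_def by auto
  have deg_mul: "weighted_degree v (minkowski_sum M N) = weighted_degree v M + weighted_degree v N"
    if "?pp M g" "?pp N h" for M N g h
    using fin[OF that(1)] fin[OF that(2)] by (intro weighted_degree_minkowski_sum)
  have const: "?pp {\<lambda>_. 0} p" if "p \<in> P" for p
    using positive_elements_base[OF that] unfolding positive_polynomial_def monomial_value_def
    by (auto intro!: exI[of _ "\<lambda>_. p"])
  have deg0: "weighted_degree v {\<lambda>_. 0} = 0" unfolding weighted_degree_def by simp
  have uniq: "d = e" if fd: "V f d" and fe: "V f e" for f d e
  proof -
    obtain g h M N where 1: "?pp M g" "?pp N h" "f * h = g"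
      "d = weighted_degree v M - weighted_degree v N" using fd unfolding V_def by blast
    obtain g' h' M' N' where 2: "?pp M' g'" "?pp N' h'" "f * h' = g'"
      "e = weighted_degree v M' - weighted_degree v N'" using fe unfolding V_def by blast
    have "g * h' = g' * h" using 1 2 by (auto simp: mult_ac)
    then have "minkowski_sum M N' = minkowski_sum M' N"
      using positive_polynomial_support_unique[OF emb ind mul[OF 1(1) 2(2)]] mul[OF 2(1) 1(2)]
      by simp
    then show "d = e"
      using deg_mul[OF 1(1) 2(2)] deg_mul[OF 2(1) 1(2)] 1(4) 2(4) by simp
  qed
  have P: "V p 0" if "p \<in> P" for p
    unfolding V_def using const[OF that] const[OF oneP] deg0 by force
  have vals: "V f d \<Longrightarrow> V g e \<Longrightarrow> V (f * g) (d + e) \<and> V (f + g) (max d e)" for f g d e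
  proof -
    assume "V f d" "V g e"
    then obtain a b M N a' b' M' N' where
      1: "?pp M a" "?pp N b" "f * b = a" "d = weighted_degree v M - weighted_degree v N"
      and 2: "?pp M' a'" "?pp N' b'" "g * b' = a'" "e = weighted_degree v M' - weighted_degree v N'"
      unfolding V_def by blast
    have "f * g * (b * b') = a * a'" using 1(3) 2(3) by (auto simp: mult_ac)
    moreover have "d + e = weighted_degree v (minkowski_sum M M') - weighted_degree v (minkowski_sum N N')"
      using deg_mul[OF 1(1) 2(1)] deg_mul[OF 1(2) 2(2)] 1(4) 2(4) by simp
    ultimately have "V (f * g) (d + e)"
      unfolding V_def using mul[OF 1(1) 2(1)] mul[OF 1(2) 2(2)] by blast
    moreover have "V (f + g) (max d e)"
    proof -
      have s: "?pp (minkowski_sum M N' \<union> minkowski_sum M' N) (a * b' + a' * b)"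
        using mul[OF 1(1) 2(2)] mul[OF 2(1) 1(2)] by (rule positive_polynomial_add)
      have "weighted_degree v (minkowski_sum M N' \<union> minkowski_sum M' N)
          = max (weighted_degree v M + weighted_degree v N') (weighted_degree v M' + weighted_degree v N)"
        using fin[OF mul[OF 1(1) 2(2)]] fin[OF mul[OF 2(1) 1(2)]]
          deg_mul[OF 1(1) 2(2)] deg_mul[OF 2(1) 1(2)] by (simp add: weighted_degree_union)
      then have "max d e = weighted_degree v (minkowski_sum M N' \<union> minkowski_sum M' N)
          - weighted_degree v (minkowski_sum N N')"
        using deg_mul[OF 1(2) 2(2)] 1(4) 2(4) by (simp add: max_def)
      moreover have "(f + g) * (b * b') = a * b' + a' * b"
        using 1(3) 2(3) by (auto simp: algebra_simps)
      ultimately show ?thesis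
        unfolding V_def using s mul[OF 1(2) 2(2)] by blast
    qed
    ultimately show ?thesis by blast
  qed
  have inv: "V (inverse f) (- d)" and nonzero: "f \<noteq> 0" if "V f d" for f d
  proof -
    obtain g h M N where 1: "?pp M g" "?pp N h" "f * h = g"
      "d = weighted_degree v M - weighted_degree v N" using \<open>V f d\<close> unfolding V_def by blast
    then show "f \<noteq> 0" using nz by force
    then have "inverse f * g = h" using 1 by auto
    moreover have "- d = weighted_degree v N - weighted_degree v M" using 1(4) by simp
    ultimately show "V (inverse f) (- d)" unfolding V_def using 1(1,2) by blast
  qed
  have var: "V (x i) (v i)" for i
  proof -
    let ?e = "\<lambda>j. if j = i then 1 else 0 :: nat"
    have m: "monomial_value x ?e = x i"
      unfolding monomial_value_def by (simp add: if_distrib[of "\<lambda>n. _ ^ n"] cong: if_cong)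
    have "?pp {?e} (x i)"
      using positive_elements_base[OF oneP] m unfolding positive_polynomial_def
      by (auto intro!: exI[of _ "\<lambda>_. 1"])
    moreover have "weighted_degree v {?e} = v i"
      unfolding weighted_degree_def by (simp add: if_distrib[of "\<lambda>n. n * _"] if_distrib[of real] cong: if_cong)
    moreover have "x i * 1 = x i" by simp
    moreover have "v i = weighted_degree v {?e} - weighted_degree v {\<lambda>_. 0}"
      using deg0 by (simp add: calculation(2))
    ultimately show ?thesis
      unfolding V_def using const[OF oneP] by blast
  qed
  define D where "D = {f. \<exists>d. V f d}"
  define w where "w f = (THE d. V f d)" for f
  have w: "w f = d" if "V f d" for f d
    unfolding w_def using that uniq by blast
  have "tropical_valuation P D w"
    unfolding tropical_valuation_def
  proof (intro conjI ballI)
    show "0 \<notin> D" using nonzero D_def by auto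
    show "P \<subseteq> D" using P D_def by auto
    show "w p = 0" if "p \<in> P" for p using that P w by auto
    show "inverse f \<in> D" "w (inverse f) = - w f" if "f \<in> D" for f
      using that inv w D_def by auto
    show "f * g \<in> D" "w (f * g) = w f + w g" "f + g \<in> D" "w (f + g) = max (w f) (w g)"
      if "f \<in> D" "g \<in> D" for f g
    proof -
      obtain d where d: "V f d" using \<open>f \<in> D\<close> D_def by auto
      obtain e where e: "V g e" using \<open>g \<in> D\<close> D_def by auto
      show "f * g \<in> D" "w (f * g) = w f + w g" "f + g \<in> D" "w (f + g) = max (w f) (w g)"
        using d e vals[OF d e] w D_def by auto
    qed
  qed
  then show ?thesis using var w D_def by (intro exI[of _ D] exI[of _ w]) auto
qed

section \<open>Mutation and its tropicalisation\<close>

text \<open>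
  The part of the seed axioms that the valuation needs and that is visibly stable under mutation;
  freeness of the cluster is replaced by membership in \<open>D\<close>, which also keeps the cluster variables
  nonzero.
\<close>

definition positive_seed :: "'f::field set \<Rightarrow> 'f set \<Rightarrow> ('v::finite, 'f) labelled_seed \<Rightarrow> bool" where
  "positive_seed P D s \<longleftrightarrow> range (cluster s) \<subseteq> D \<and> range (coefficients s) \<subseteq> P \<and>
     (\<forall>i j. exchange_matrix s i j = - exchange_matrix s j i)"

definition tropical_mutation ::
  "'v::finite \<Rightarrow> ('v \<Rightarrow> 'v \<Rightarrow> int) \<Rightarrow> ('v \<Rightarrow> real) \<Rightarrow> 'v \<Rightarrow> real" where
  "tropical_mutation k b u =
     u(k := max (\<Sum>i\<in>UNIV. max 0 (b i k) * u i) (\<Sum>i\<in>UNIV. max 0 (- b i k) * u i) - u k)"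

lemma tropical_valuation_power:
  assumes w: "tropical_valuation P D w" and "1 \<in> P" "f \<in> D"
  shows "f ^ n \<in> D \<and> w (f ^ n) = n * w f"
  using assms unfolding tropical_valuation_def
  by (induction n) (auto simp: distrib_right)

lemma tropical_valuation_prod:
  assumes w: "tropical_valuation P D w" and one: "1 \<in> P" and x: "\<And>i. x i \<in> D" and "finite I"
  shows "(\<Prod>i\<in>I. x i ^ e i) \<in> D \<and> w (\<Prod>i\<in>I. x i ^ e i) = (\<Sum>i\<in>I. e i * w (x i))"
  using \<open>finite I\<close>
proof (induction I)
  case empty
  then show ?case using w one unfolding tropical_valuation_def by auto
next
  case (insert i I)
  then show ?case
    using w tropical_valuation_power[OF w one x, of i "e i"]
    unfolding tropical_valuation_def by auto
qed

lemma semifieldD: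
  assumes "is_semifield P pl"
  shows "1 \<in> P" "0 \<notin> P" "p \<in> P \<Longrightarrow> q \<in> P \<Longrightarrow> p * q \<in> P" "p \<in> P \<Longrightarrow> inverse p \<in> P"
    "p \<in> P \<Longrightarrow> q \<in> P \<Longrightarrow> pl p q \<in> P" "p \<in> P \<Longrightarrow> q \<in> P \<Longrightarrow> pl p q = pl q p"
    "p \<in> P \<Longrightarrow> q \<in> P \<Longrightarrow> r \<in> P \<Longrightarrow> p * pl q r = pl (p * q) (p * r)"
  using assms unfolding is_semifield_def by blast+

lemma semifield_power:
  assumes "is_semifield P pl" "p \<in> P"
  shows "p ^ n \<in> P"
  by (induction n) (use assms semifieldD in auto)

lemma semifield_power_int:
  assumes "is_semifield P pl" "p \<in> P"
  shows "p powi n \<in> P"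
  using semifield_power[OF assms] semifield_power[OF assms(1) semifieldD(4)[OF assms]]
  unfolding power_int_def by auto

text \<open>
  The exchange relation is subtraction free, and the factors \<open>y\<^sub>k\<close> and \<open>y\<^sub>k \<oplus> 1\<close> lie in \<open>P\<close> and have
  value 0. This is why the coefficients do not occur in the tropical mutation.
\<close>

lemma mutate_positive_seed:
  assumes sf: "is_semifield P pl" and w: "tropical_valuation P D w" and s: "positive_seed P D s"
  shows "positive_seed P D (mutate pl k s)"
    and "w (cluster (mutate pl k s) i) =
      tropical_mutation k (exchange_matrix s) (\<lambda>j. w (cluster s j)) i"
proof -
  let ?b = "exchange_matrix s" and ?x = "cluster s" and ?y = "coefficients s"
  have x: "?x i \<in> D" and y: "?y i \<in> P" and skew: "?b i j = - ?b j i" for i j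
    using s unfolding positive_seed_def by blast+
  have one: "1 \<in> P" and pl: "pl (?y i) 1 \<in> P" for i using semifieldD[OF sf] y by auto
  have D: "P \<subseteq> D" "\<And>p. p \<in> P \<Longrightarrow> w p = 0" "\<And>f. f \<in> D \<Longrightarrow> inverse f \<in> D \<and> w (inverse f) = - w f"
    "\<And>f g. f \<in> D \<Longrightarrow> g \<in> D \<Longrightarrow> f * g \<in> D \<and> w (f * g) = w f + w g"
    "\<And>f g. f \<in> D \<Longrightarrow> g \<in> D \<Longrightarrow> f + g \<in> D \<and> w (f + g) = max (w f) (w g)"
    using w unfolding tropical_valuation_def by blast+
  define p where "p = (\<Prod>i\<in>UNIV. ?x i ^ nat (?b i k))"
  define q where "q = (\<Prod>i\<in>UNIV. ?x i ^ nat (- ?b i k))"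
  define d where "d = pl (?y k) 1 * ?x k"
  define x' where "x' = (?y k * p + q) / d"
  have p: "p \<in> D" "w p = (\<Sum>i\<in>UNIV. nat (?b i k) * w (?x i))"
    unfolding p_def using tropical_valuation_prod[OF w one, where x = ?x and I = UNIV] x by auto
  have q: "q \<in> D" "w q = (\<Sum>i\<in>UNIV. nat (- ?b i k) * w (?x i))"
    unfolding q_def using tropical_valuation_prod[OF w one, where x = ?x and I = UNIV] x by auto
  have d: "d \<in> D" "w d = w (?x k)"
    unfolding d_def using D(1,2) D(4) x pl[of k] by force+
  have yp: "?y k * p \<in> D" "w (?y k * p) = w p"
    using D(1,2,4) p y[of k] by force+
  have x': "x' \<in> D" "w x' = max (w p) (w q) - w (?x k)"
    unfolding x'_def divide_inverse using D(3-5) d p q yp by auto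
  have cl: "cluster (mutate pl k s) = ?x(k := x')"
    unfolding mutate_def mutate_cluster_def x'_def p_def q_def d_def by (simp add: Let_def)
  have "real (nat z) = max 0 (real_of_int z)" for z by simp
  then show "w (cluster (mutate pl k s) i) = tropical_mutation k ?b (\<lambda>j. w (?x j)) i"
    unfolding cl tropical_mutation_def using x'(2) p(2) q(2) by simp
  \<comment> \<open>The correction term in the matrix mutation is skew-symmetric because it vanishes unless \<open>a\<close> and \<open>c\<close> have opposite signs.\<close>
  have "sgn a * max 0 (- (a * c)) = - (sgn c * max 0 (- (a * c)))" for a c :: int
    by (cases a "0 :: int" rule: linorder_cases; cases c "0 :: int" rule: linorder_cases)
      (simp_all add: max_def mult_le_0_iff)
  then have skew': "mutate_matrix k ?b i j = - mutate_matrix k ?b j i" for i j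
    unfolding mutate_matrix_def using skew[of i j] skew[of j k] skew[of i k]
    by (simp add: mult.commute)
  have y': "mutate_coefficients pl k ?b ?y j \<in> P" for j
    unfolding mutate_coefficients_def
    using semifieldD(3,4)[OF sf] y semifield_power[OF sf] semifield_power_int[OF sf] pl by auto
  have "cluster (mutate pl k s) j \<in> D" for j unfolding cl using x x'(1) by simp
  moreover have "coefficients (mutate pl k s) = mutate_coefficients pl k ?b ?y"
    "exchange_matrix (mutate pl k s) = mutate_matrix k ?b"
    by (simp_all add: mutate_def)
  ultimately show "positive_seed P D (mutate pl k s)"
    unfolding positive_seed_def using skew' y' by (metis image_subsetI)
qed

text \<open>
  For the coefficients and the cluster, the reason is \<open>y\<inverse> \<oplus> 1 = y\<inverse> (y \<oplus> 1)\<close> in the semifield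
  together with \<open>b\<^sub>k\<^sub>k = 0\<close>: the second exchange polynomial is \<open>y\<inverse>\<close> times the first, and the
  auxiliary additions contribute the same factor.
\<close>

lemma mutate_mutate:
  assumes sf: "is_semifield P pl" and w: "tropical_valuation P D w" and s: "positive_seed P D s"
  shows "mutate pl k (mutate pl k s) = s"
proof -
  let ?b = "exchange_matrix s" and ?x = "cluster s" and ?y = "coefficients s"
  let ?b' = "mutate_matrix k ?b" and ?y' = "mutate_coefficients pl k ?b ?y"
  have x: "?x i \<in> D" and y: "?y i \<in> P" and skew: "?b i j = - ?b j i" for i j
    using s unfolding positive_seed_def by blast+
  have nz: "0 \<notin> D" "P \<subseteq> D" using w unfolding tropical_valuation_def by auto
  have bk: "?b' i k = - ?b i k" "?b' k i = - ?b k i" for i unfolding mutate_matrix_def by auto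
  have kk: "?b k k = 0" using skew[of k k] by simp
  have y'k: "?y' k = inverse (?y k)" unfolding mutate_coefficients_def by simp
  have yk: "?y k \<noteq> 0" "pl (?y k) 1 \<noteq> 0" "pl (inverse (?y k)) 1 = pl (?y k) 1 * inverse (?y k)"
  proof -
    have P: "inverse (?y k) \<in> P" "1 \<in> P" "?y k \<in> P" using semifieldD[OF sf] y by auto
    show "?y k \<noteq> 0" "pl (?y k) 1 \<noteq> 0" using semifieldD(2,5)[OF sf] P by metis+
    have "inverse (?y k) * pl (?y k) 1 = pl (inverse (?y k) * ?y k) (inverse (?y k) * 1)"
      using semifieldD(7)[OF sf] P by blast
    then show "pl (inverse (?y k)) 1 = pl (?y k) 1 * inverse (?y k)"
      using \<open>?y k \<noteq> 0\<close> semifieldD(6)[OF sf P(2,1)] by (simp add: mult.commute)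
  qed
  have mat: "mutate_matrix k ?b' = ?b"
    by (intro ext) (auto simp: mutate_matrix_def)
  have co: "mutate_coefficients pl k ?b' ?y' = ?y"
  proof
    fix j
    show "mutate_coefficients pl k ?b' ?y' j = ?y j"
    proof (cases "j = k")
      case True
      then show ?thesis by (simp add: mutate_coefficients_def)
    next
      case False
      let ?e = "?b k j" and ?Y = "?y k" and ?A = "pl (?y k) 1"
      have "mutate_coefficients pl k ?b' ?y' j =
          ?y j * ?Y ^ nat ?e * ?A powi (- ?e) * inverse ?Y ^ nat (- ?e) * (?A * inverse ?Y) powi ?e"
        using False bk y'k yk(3) by (simp add: mutate_coefficients_def)
      also have "\<dots> = ?y j"
        using yk(1,2) by (cases "?e \<ge> 0")
          (auto simp: power_int_def power_mult_distrib field_simps)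
      finally show ?thesis .
    qed
  qed
  let ?p = "\<Prod>i\<in>UNIV. ?x i ^ nat (?b i k)" and ?q = "\<Prod>i\<in>UNIV. ?x i ^ nat (- ?b i k)"
  define x' where "x' = (?y k * ?p + ?q) / (pl (?y k) 1 * ?x k)"
  have cl: "cluster (mutate pl k s) = ?x(k := x')"
    unfolding mutate_def mutate_cluster_def x'_def by (simp add: Let_def)
  have x'nz: "x' \<noteq> 0"
  proof -
    have "positive_seed P D (mutate pl k s)" using mutate_positive_seed(1)[OF sf w s] .
    then have "x' \<in> D" using cl unfolding positive_seed_def by (metis fun_upd_same range_subsetD)
    with nz show ?thesis by auto
  qed
  have pr: "(\<Prod>i\<in>UNIV. (?x(k := x')) i ^ nat (?b i k)) = ?p"
      "(\<Prod>i\<in>UNIV. (?x(k := x')) i ^ nat (- ?b i k)) = ?q"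
    by (rule prod.cong; simp add: kk)+
  have xk: "?x k \<noteq> 0" using nz x by metis
  have num: "?y k * ?p + ?q = x' * (pl (?y k) 1 * ?x k)"
    unfolding x'_def using xk yk(2) by simp
  have "mutate_cluster pl k (mutate pl k s) =
      (?x(k := x'))(k := (inverse (?y k) * ?q + ?p) / (pl (?y k) 1 * inverse (?y k) * x'))"
    unfolding mutate_cluster_def[of pl k "mutate pl k s"] cl
    using pr by (simp add: Let_def mutate_def bk y'k yk(3) cong: if_cong)
  also have "(inverse (?y k) * ?q + ?p) = inverse (?y k) * (?y k * ?p + ?q)"
    using yk(1) by (simp add: distrib_left)
  also have "(?x(k := x'))(k := inverse (?y k) * (?y k * ?p + ?q) / (pl (?y k) 1 * inverse (?y k) * x')) = ?x"
    unfolding num using yk(1,2) x'nz by (intro ext) (simp add: field_simps)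
  finally show ?thesis
    using mat co by (simp add: mutate_def)
qed

section \<open>Balls in the exchange graph\<close>

abbreviation mutate_along ::
  "('f \<Rightarrow> 'f \<Rightarrow> 'f) \<Rightarrow> 'v list \<Rightarrow> ('v::finite, 'f::field) labelled_seed \<Rightarrow> ('v, 'f) labelled_seed" where
  "mutate_along pl \<equiv> fold (mutate pl)"

lemma relabel_relabel: "relabel \<sigma> (relabel \<tau> s) = relabel (\<tau> \<circ> \<sigma>) s"
  unfolding relabel_def by simp

lemma mutate_relabel:
  assumes "bij \<sigma>"
  shows "mutate pl k (relabel \<sigma> s) = relabel \<sigma> (mutate pl (\<sigma> k) s)"
proof -
  have inj: "\<sigma> i = \<sigma> j \<longleftrightarrow> i = j" for i j using assms by (metis bij_pointE)
  have pr: "(\<Prod>i\<in>UNIV. f (\<sigma> i)) = (\<Prod>i\<in>UNIV. f i)" for f :: "'a \<Rightarrow> 'b"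
    using prod.reindex_bij_betw[OF assms] .
  have 1: "mutate_matrix k (\<lambda>i j. exchange_matrix s (\<sigma> i) (\<sigma> j)) =
      (\<lambda>i j. mutate_matrix (\<sigma> k) (exchange_matrix s) (\<sigma> i) (\<sigma> j))"
    by (intro ext) (auto simp: mutate_matrix_def inj)
  have 2: "mutate_coefficients pl k (\<lambda>i j. exchange_matrix s (\<sigma> i) (\<sigma> j)) (\<lambda>i. coefficients s (\<sigma> i)) =
      (\<lambda>i. mutate_coefficients pl (\<sigma> k) (exchange_matrix s) (coefficients s) (\<sigma> i))"
    by (intro ext) (auto simp: mutate_coefficients_def inj)
  have 3: "mutate_cluster pl k (relabel \<sigma> s) = (\<lambda>i. mutate_cluster pl (\<sigma> k) s (\<sigma> i))"
    using pr[of "\<lambda>i. cluster s i ^ nat (exchange_matrix s i (\<sigma> k))"]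
      pr[of "\<lambda>i. cluster s i ^ nat (- exchange_matrix s i (\<sigma> k))"]
    by (intro ext) (auto simp: mutate_cluster_def relabel_def inj Let_def)
  show ?thesis unfolding mutate_def using 1 2 3 by (simp add: relabel_def)
qed

lemma mem_seed_of: "t \<in> seed_of s \<longleftrightarrow> (\<exists>\<sigma>. bij \<sigma> \<and> t = relabel \<sigma> s)"
  unfolding seed_of_def by blast

lemma seed_of_relabel:
  assumes "bij \<sigma>"
  shows "seed_of (relabel \<sigma> s) = seed_of s"
proof (rule set_eqI)
  fix t
  have "\<exists>\<rho>. bij \<rho> \<and> t = relabel \<rho> s" if "bij \<tau>" "t = relabel \<tau> (relabel \<sigma> s)" for \<tau>
    using that assms relabel_relabel bij_comp by metis
  moreover have "\<exists>\<rho>. bij \<rho> \<and> t = relabel \<rho> (relabel \<sigma> s)" if "bij \<tau>" "t = relabel \<tau> s" for \<tau>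
  proof (intro exI conjI)
    show "bij (inv \<sigma> \<circ> \<tau>)" using that assms by (simp add: bij_comp bij_imp_bij_inv)
    have "\<sigma> \<circ> (inv \<sigma> \<circ> \<tau>) = \<tau>" using assms by (simp add: fun_eq_iff bij_is_surj surj_f_inv_f)
    then show "t = relabel (inv \<sigma> \<circ> \<tau>) (relabel \<sigma> s)" using that by (simp add: relabel_relabel)
  qed
  ultimately show "t \<in> seed_of (relabel \<sigma> s) \<longleftrightarrow> t \<in> seed_of s"
    unfolding mem_seed_of by blast
qed

lemma self_in_seed_of: "s \<in> seed_of s"
  unfolding mem_seed_of by (intro exI[of _ id]) (simp add: relabel_def)

text \<open>
  Mutation commutes with relabelling, so the neighbours of a class can be computed from one fixed
  representative.
\<close>

lemma exchange_edges_seed_of: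
  "(seed_of s, T) \<in> exchange_edges pl \<longleftrightarrow> (\<exists>k. T = seed_of (mutate pl k s))"
proof
  assume "(seed_of s, T) \<in> exchange_edges pl"
  then obtain t k where "t \<in> seed_of s" "T = seed_of (mutate pl k t)"
    unfolding exchange_edges_def by auto
  then obtain \<sigma> where "bij \<sigma>" "T = seed_of (mutate pl k (relabel \<sigma> s))"
    unfolding mem_seed_of by blast
  then show "\<exists>k. T = seed_of (mutate pl k s)"
    using mutate_relabel seed_of_relabel by metis
next
  assume "\<exists>k. T = seed_of (mutate pl k s)"
  then show "(seed_of s, T) \<in> exchange_edges pl"
    unfolding exchange_edges_def using self_in_seed_of by blast
qed

text \<open>
  Walks in the exchange graph are words in the index set. This makes balls finite, and it allows
  walks to be reversed by reversing the word.
\<close>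

lemma exchange_walk_seed_of:
  "(seed_of s, T) \<in> exchange_edges pl ^^ m \<longleftrightarrow>
     (\<exists>ks. length ks = m \<and> T = seed_of (mutate_along pl ks s))"
proof (induction m arbitrary: s)
  case 0
  then show ?case by auto
next
  case (Suc m)
  have "(seed_of s, T) \<in> exchange_edges pl ^^ Suc m \<longleftrightarrow>
      (\<exists>k. (seed_of (mutate pl k s), T) \<in> exchange_edges pl ^^ m)"
    using exchange_edges_seed_of[of s _ pl] relpow_Suc_I2[of "seed_of s"] relpow_Suc_D2[of "seed_of s" T m]
    by metis
  also have "\<dots> \<longleftrightarrow> (\<exists>k ks. length ks = m \<and> T = seed_of (mutate_along pl (k # ks) s))"
    using Suc.IH by simp
  also have "\<dots> \<longleftrightarrow> (\<exists>ks. length ks = Suc m \<and> T = seed_of (mutate_along pl ks s))"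
    by (metis length_Suc_conv)
  finally show ?case .
qed

lemma seeds_within_seed_of:
  "seeds_within pl (seed_of s) n = (\<lambda>ks. seed_of (mutate_along pl ks s)) ` {ks. length ks \<le> n}"
  unfolding seeds_within_def exchange_walk_seed_of by auto

lemma finite_seeds_within: "finite (seeds_within pl (seed_of s) n)"
  unfolding seeds_within_seed_of
  using finite_lists_length_le[of "UNIV :: 'a set" n] by simp

lemma mutate_along_positive_seed:
  assumes "is_semifield P pl" "tropical_valuation P D w" "positive_seed P D s"
  shows "positive_seed P D (mutate_along pl ks s)"
  using assms(3) by (induction ks arbitrary: s) (use mutate_positive_seed(1)[OF assms(1,2)] in auto)

lemma mutate_along_rev:
  assumes "is_semifield P pl" "tropical_valuation P D w" "positive_seed P D s"
  shows "mutate_along pl (rev ks) (mutate_along pl ks s) = s"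
  using assms(3)
proof (induction ks arbitrary: s)
  case (Cons k ks)
  then show ?case
    using mutate_positive_seed(1)[OF assms(1,2) Cons.prems, of k]
      mutate_mutate[OF assms(1,2) Cons.prems, of k] by simp
qed simp

text \<open>
  Since \<open>b\<^sub>k\<^sub>k = 0\<close>, the maximum does not depend on \<open>u\<^sub>k\<close>, and the map is a reflection in \<open>u\<^sub>k\<close>.
\<close>

lemma tropical_mutation_involution:
  assumes "b k k = 0"
  shows "tropical_mutation k b (tropical_mutation k b u) = u"
proof -
  let ?u = "tropical_mutation k b u"
  have "(\<Sum>i\<in>UNIV. max 0 (real_of_int (b i k)) * ?u i) = (\<Sum>i\<in>UNIV. max 0 (real_of_int (b i k)) * u i)"
    "(\<Sum>i\<in>UNIV. max 0 (- real_of_int (b i k)) * ?u i) = (\<Sum>i\<in>UNIV. max 0 (- real_of_int (b i k)) * u i)"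
    using assms by (intro sum.cong; auto simp: tropical_mutation_def)+
  then have "tropical_mutation k b ?u = ?u(k := max (\<Sum>i\<in>UNIV. max 0 (real_of_int (b i k)) * u i)
      (\<Sum>i\<in>UNIV. max 0 (- real_of_int (b i k)) * u i) - ?u k)"
    by (subst tropical_mutation_def) (simp only:)
  then show ?thesis by (simp add: tropical_mutation_def)
qed

text \<open>
  A valuation exists for arbitrary weights at the seed \<open>s\<close>. Pulling \<open>u\<close> back along the word by
  tropical mutations gives the weights at \<open>s\<close> that produce \<open>u\<close> at its end.
\<close>

lemma tropical_values_prescribed:
  fixes s :: "('v::finite, 'f::field_char_0) labelled_seed"
  assumes sf: "is_semifield P pl" and emb: "group_ring_embeds P" and s: "is_labelled_seed P s"
  shows "\<exists>D w. tropical_valuation P D w \<and> positive_seed P D s \<and>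
    (\<forall>i. w (cluster (mutate_along pl ks s) i) = u i)"
proof -
  have skew: "exchange_matrix s i j = - exchange_matrix s j i" for i j
    using s unfolding is_labelled_seed_def by blast
  have ex: "\<exists>v. \<forall>D w. tropical_valuation P D w \<longrightarrow> positive_seed P D s \<longrightarrow>
      (\<lambda>i. w (cluster s i)) = v \<longrightarrow> (\<lambda>i. w (cluster (mutate_along pl ks s) i)) = u"
    for s :: "('v, 'f) labelled_seed"
  proof (induction ks arbitrary: s)
    case Nil
    then show ?case by auto
  next
    case (Cons k ks)
    obtain v where v: "\<And>D w. tropical_valuation P D w \<Longrightarrow> positive_seed P D (mutate pl k s) \<Longrightarrow>
        (\<lambda>i. w (cluster (mutate pl k s) i)) = v \<Longrightarrow>
        (\<lambda>i. w (cluster (mutate_along pl ks (mutate pl k s)) i)) = u"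
      using Cons.IH[of "mutate pl k s"] by blast
    have "(\<lambda>i. w (cluster (mutate_along pl (k # ks) s) i)) = u"
      if w: "tropical_valuation P D w" and pos: "positive_seed P D s"
        and vs: "(\<lambda>i. w (cluster s i)) = tropical_mutation k (exchange_matrix s) v" for D w
    proof -
      have "exchange_matrix s k k = - exchange_matrix s k k"
        using pos unfolding positive_seed_def by blast
      then have "(\<lambda>i. w (cluster (mutate pl k s) i)) = v"
        using mutate_positive_seed(2)[OF sf w pos, of k] vs
          tropical_mutation_involution[of "exchange_matrix s" k v] by auto
      then show ?thesis using v[OF w mutate_positive_seed(1)[OF sf w pos]] by simp
    qed
    then show ?case by blast
  qed
  then obtain v where v: "\<And>D w. tropical_valuation P D w \<Longrightarrow> positive_seed P D s \<Longrightarrow>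
      (\<lambda>i. w (cluster s i)) = v \<Longrightarrow> (\<lambda>i. w (cluster (mutate_along pl ks s) i)) = u"
    by blast
  obtain D w where w: "tropical_valuation P D w" "\<forall>i. cluster s i \<in> D \<and> w (cluster s i) = v i"
    using tropical_valuation_exists[OF sf emb, of "cluster s" v] s
    unfolding is_labelled_seed_def free_generating_set_def by blast
  have "positive_seed P D s"
    using w(2) s unfolding positive_seed_def is_labelled_seed_def by blast
  with v[OF w(1)] w show ?thesis by (auto simp: fun_eq_iff)
qed

section \<open>Symbolic tropical mutation\<close>

text \<open>
  The linear form \<open>a\<beta> + c\<tau>\<close> in the two parameters is stored as \<open>(a, c)\<close>. Vertices are numbered, and
  matrices and weights are lists, so that a whole word of mutations can be evaluated by rewriting.
\<close>

type_synonym form = "int \<times> int"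

definition form_value :: "real \<times> real \<Rightarrow> form \<Rightarrow> real" where
  "form_value z p = of_int (fst p) * fst z + of_int (snd p) * snd z"

text \<open>
  For \<open>\<epsilon> = 1\<close> and \<open>\<epsilon> = -1\<close>, these are the two arguments of the maximum in the tropical mutation.
\<close>

definition form_flow :: "int \<Rightarrow> int list list \<Rightarrow> form list \<Rightarrow> nat \<Rightarrow> form" where
  "form_flow \<epsilon> B f k =
     (sum_list (map (\<lambda>i. max 0 (\<epsilon> * B ! i ! k) * fst (f ! i)) [0..<length f]),
      sum_list (map (\<lambda>i. max 0 (\<epsilon> * B ! i ! k) * snd (f ! i)) [0..<length f]))"

definition dominates :: "form \<Rightarrow> form \<Rightarrow> bool" where
  "dominates p q \<longleftrightarrow> fst q \<le> fst p \<and> snd q \<le> snd p"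

definition matrix_mutation :: "nat \<Rightarrow> int list list \<Rightarrow> int list list" where
  "matrix_mutation k B =
     map (\<lambda>i. map (\<lambda>j. if i = k \<or> j = k then - (B ! i ! j)
       else B ! i ! j + sgn (B ! i ! k) * max 0 (B ! i ! k * B ! k ! j)) [0..<length B]) [0..<length B]"

text \<open>
  The mutation is defined only if one argument of the maximum exceeds the other coefficientwise. Then
  the same argument attains the maximum for all nonnegative parameters, and the result is linear.
\<close>

definition symbolic_mutation ::
  "nat \<Rightarrow> int list list \<times> form list \<Rightarrow> (int list list \<times> form list) option" where
  "symbolic_mutation k st = (case st of (B, f) \<Rightarrow>
     (let p = form_flow 1 B f k; q = form_flow (-1) B f k;
          exchange = (\<lambda>r. f[k := (fst r - fst (f ! k), snd r - snd (f ! k))])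
      in if \<not> k < length f then None
         else if dominates p q then Some (matrix_mutation k B, exchange p)
         else if dominates q p then Some (matrix_mutation k B, exchange q)
         else None))"

primrec symbolic_run ::
  "nat list \<Rightarrow> int list list \<times> form list \<Rightarrow> (int list list \<times> form list) option" where
  "symbolic_run [] st = Some st"
| "symbolic_run (k # ks) st = Option.bind (symbolic_mutation k st) (symbolic_run ks)"

text \<open>
  The map \<open>e\<close> translates positions in the lists into indices of the seed, and \<open>z = (\<beta>, \<tau>)\<close>.
\<close>

definition realizes ::
  "('f \<Rightarrow> real) \<Rightarrow> (nat \<Rightarrow> 'v) \<Rightarrow> nat \<Rightarrow> real \<times> real \<Rightarrow> ('v, 'f) labelled_seed \<Rightarrow>
     int list list \<times> form list \<Rightarrow> bool" where
  "realizes w e n z s st \<longleftrightarrow> length (fst st) = n \<and> length (snd st) = n \<and>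
     (\<forall>i<n. \<forall>j<n. exchange_matrix s (e i) (e j) = fst st ! i ! j) \<and>
     (\<forall>i<n. w (cluster s (e i)) = form_value z (snd st ! i))"

lemma dominates_form_value:
  assumes "dominates p q" "0 \<le> fst z" "0 \<le> snd z"
  shows "form_value z q \<le> form_value z p"
  using assms unfolding dominates_def form_value_def
  by (intro add_mono mult_right_mono) auto

lemma form_value_flow:
  assumes e: "bij_betw e {..<n} UNIV" and r: "realizes w e n z s (B, f)" and "k < n"
  shows "form_value z (form_flow \<epsilon> B f k) =
    (\<Sum>i\<in>UNIV. max 0 (of_int (\<epsilon> * exchange_matrix s i (e k))) * w (cluster s i))"
proof -
  have "form_value z (form_flow \<epsilon> B f k) =
      (\<Sum>i<n. max 0 (of_int (\<epsilon> * exchange_matrix s (e i) (e k))) * w (cluster s (e i)))"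
    using r \<open>k < n\<close> unfolding realizes_def form_value_def form_flow_def
    by (simp add: interv_sum_list_conv_sum_set_nat atLeast0LessThan sum_distrib_left sum.distrib
        of_int_max algebra_simps)
  also have "\<dots> = (\<Sum>i\<in>UNIV. max 0 (of_int (\<epsilon> * exchange_matrix s i (e k))) * w (cluster s i))"
    by (rule sum.reindex_bij_betw[OF e])
  finally show ?thesis .
qed

text \<open>
  Symbolic mutation is sound: its success decides the maximum in \<open>tropical_mutation\<close> on the whole
  closed quadrant.
\<close>

lemma realizes_mutate:
  assumes sf: "is_semifield P pl" and w: "tropical_valuation P D w" and s: "positive_seed P D s"
    and e: "bij_betw e {..<n} UNIV" and z: "0 \<le> fst z" "0 \<le> snd z"
    and r: "realizes w e n z s (B, f)" and run: "symbolic_mutation k (B, f) = Some st"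
  shows "k < n" "realizes w e n z (mutate pl (e k) s) st"
proof -
  let ?p = "form_flow 1 B f k" and ?q = "form_flow (-1) B f k"
  have len: "length B = n" "length f = n" using r unfolding realizes_def by auto
  show k: "k < n" using run len unfolding symbolic_mutation_def by (auto simp: Let_def split: if_splits)
  have inj: "e i = e k \<longleftrightarrow> i = k" "e k = e i \<longleftrightarrow> k = i" if "i < n" for i
    using bij_betw_imp_inj_on[OF e] that k by (auto dest: inj_onD)
  have mut: "mutate_matrix (e k) (exchange_matrix s) (e i) (e j) = matrix_mutation k B ! i ! j"
    if "i < n" "j < n" for i j
    using that k r len inj unfolding mutate_matrix_def matrix_mutation_def realizes_def by auto
  obtain m where m: "st = (matrix_mutation k B, f[k := (fst m - fst (f ! k), snd m - snd (f ! k))])"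
    and mx: "form_value z m = max (form_value z ?p) (form_value z ?q)"
    using run dominates_form_value[OF _ z, of ?p ?q] dominates_form_value[OF _ z, of ?q ?p]
    unfolding symbolic_mutation_def by (auto simp: Let_def max_def split: if_splits)
  have flows: "form_value z m =
      max (\<Sum>i\<in>UNIV. max 0 (of_int (exchange_matrix s i (e k))) * w (cluster s i))
          (\<Sum>i\<in>UNIV. max 0 (- of_int (exchange_matrix s i (e k))) * w (cluster s i))"
    unfolding mx using form_value_flow[OF e r k, of 1] form_value_flow[OF e r k, of "-1"] by simp
  have "w (cluster (mutate pl (e k) s) (e i)) = form_value z (snd st ! i)" if "i < n" for i
  proof (cases "i = k")
    case True
    have "form_value z (fst m - fst (f ! k), snd m - snd (f ! k)) = form_value z m - form_value z (f ! k)"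
      unfolding form_value_def by (simp add: algebra_simps)
    then show ?thesis
      using True flows k r len mutate_positive_seed(2)[OF sf w s, of "e k" "e k"]
      unfolding tropical_mutation_def m realizes_def by simp
  next
    case False
    then show ?thesis
      using that r inj mutate_positive_seed(2)[OF sf w s, of "e k" "e i"]
      unfolding tropical_mutation_def m realizes_def by simp
  qed
  then show "realizes w e n z (mutate pl (e k) s) st"
    unfolding realizes_def using mut len m by (simp add: matrix_mutation_def mutate_def)
qed

lemma realizes_mutate_along:
  assumes sf: "is_semifield P pl" and w: "tropical_valuation P D w" and s: "positive_seed P D s"
    and e: "bij_betw e {..<n} UNIV" and z: "0 \<le> fst z" "0 \<le> snd z"
    and r: "realizes w e n z s st" and run: "symbolic_run ks st = Some st'"
  shows "realizes w e n z (mutate_along pl (map e ks) s) st'"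
  using s r run
proof (induction ks arbitrary: s st)
  case (Cons k ks)
  obtain st1 where st1: "symbolic_mutation k st = Some st1" "symbolic_run ks st1 = Some st'"
    using Cons.prems(3) by (auto simp: bind_eq_Some_conv)
  obtain B f where "st = (B, f)" by (cases st)
  then have "realizes w e n z (mutate pl (e k) s) st1"
    using realizes_mutate(2)[OF sf w Cons.prems(1) e z] Cons.prems(2) st1(1) by blast
  then show ?case
    using Cons.IH[OF mutate_positive_seed(1)[OF sf w Cons.prems(1)] _ st1(2)] by simp
qed simp

section \<open>Returning words\<close>

text \<open>
  The entries of \<open>M\<close> are the forms reached at the vertices \<open>b\<close> and \<open>t\<close>. The weights there are \<open>\<rho>\<beta>\<close> and
  \<open>\<rho>\<tau>\<close>, which explains the division; the new parameters need not be integral combinations of the old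
  ones.
\<close>

definition form_action :: "int \<Rightarrow> form \<times> form \<Rightarrow> real \<times> real \<Rightarrow> real \<times> real" where
  "form_action \<rho> M z = (form_value z (fst M) / of_int \<rho>, form_value z (snd M) / of_int \<rho>)"

text \<open>
  After the word has been carried out, position \<open>\<pi> ! i\<close> plays the role of position \<open>i\<close>: the matrix is
  the old one, and the weights are the old forms at the new parameters. Positions 0 and 1 are \<open>b\<close> and
  \<open>t\<close>. The equations are multiplied by \<open>\<rho>\<close> to stay in the integers.
\<close>

definition returning_word ::
  "int list list \<times> form list \<Rightarrow> nat list \<Rightarrow> nat list \<Rightarrow> form \<times> form \<Rightarrow> bool" where
  "returning_word st ks \<pi> M \<longleftrightarrow>
     (case st of (B, f) \<Rightarrow> let n = length B; \<rho> = fst (f ! 0) in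
        distinct \<pi> \<and> length \<pi> = n \<and> list_all (\<lambda>i. i < n) \<pi> \<and>
        (case symbolic_run ks st of None \<Rightarrow> False | Some (B', f') \<Rightarrow>
           list_all (\<lambda>i. list_all (\<lambda>j. B' ! (\<pi> ! i) ! (\<pi> ! j) = B ! i ! j) [0..<n]) [0..<n] \<and>
           list_all (\<lambda>i.
              \<rho> * fst (f' ! (\<pi> ! i)) = fst (f ! i) * fst (fst M) + snd (f ! i) * fst (snd M) \<and>
              \<rho> * snd (f' ! (\<pi> ! i)) = fst (f ! i) * snd (fst M) + snd (f ! i) * snd (snd M)) [0..<n]))"

definition standard_seed ::
  "'f::field set \<Rightarrow> 'f set \<Rightarrow> ('f \<Rightarrow> real) \<Rightarrow> int list list \<times> form list \<Rightarrow>
     ('v::finite, 'f) seed \<Rightarrow> real \<times> real \<Rightarrow> bool" where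
  "standard_seed P D w st T z \<longleftrightarrow>
     (\<exists>s e. T = seed_of s \<and> positive_seed P D s \<and> bij_betw e {..<length (fst st)} UNIV \<and>
        realizes w e (length (fst st)) z s st)"

abbreviation quadrant :: "(real \<times> real) set" where
  "quadrant \<equiv> {0<..} \<times> {0<..}"

text \<open>
  The labelling \<open>e\<close> of the standard quiver is replaced by \<open>e \<circ> \<pi>\<close>, so the word can be applied again
  to the new seed. This makes arbitrary compositions of returning words possible.
\<close>

lemma standard_seed_returning_word:
  assumes sf: "is_semifield P pl" and w: "tropical_valuation P D w"
    and T: "standard_seed P D w st T z" and z: "z \<in> quadrant"
    and ret: "returning_word st ks \<pi> M" and \<rho>: "fst (snd st ! 0) > 0"
  shows "\<exists>T'. (T, T') \<in> exchange_edges pl ^^ length ks \<and>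
    standard_seed P D w st T' (form_action (fst (snd st ! 0)) M z)"
proof -
  let ?n = "length (fst st)" and ?\<rho> = "fst (snd st ! 0)"
  obtain s e where s: "T = seed_of s" "positive_seed P D s" and e: "bij_betw e {..<?n} UNIV"
    and r: "realizes w e ?n z s st"
    using T unfolding standard_seed_def by blast
  obtain B f where st: "st = (B, f)" by (cases st)
  have \<pi>: "distinct \<pi>" "length \<pi> = ?n" "set \<pi> \<subseteq> {..<?n}"
    using ret unfolding returning_word_def st by (auto simp: Let_def list_all_iff)
  obtain B' f' where run: "symbolic_run ks st = Some (B', f')"
    and B': "\<And>i j. i < ?n \<Longrightarrow> j < ?n \<Longrightarrow> B' ! (\<pi> ! i) ! (\<pi> ! j) = B ! i ! j"
    and f': "\<And>i. i < ?n \<Longrightarrow>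
        ?\<rho> * fst (f' ! (\<pi> ! i)) = fst (f ! i) * fst (fst M) + snd (f ! i) * fst (snd M) \<and>
        ?\<rho> * snd (f' ! (\<pi> ! i)) = fst (f ! i) * snd (fst M) + snd (f ! i) * snd (snd M)"
    using ret unfolding returning_word_def st
    by (auto simp: Let_def list_all_iff split: option.splits)
  let ?s = "mutate_along pl (map e ks) s" and ?e = "\<lambda>i. e (\<pi> ! i)"
  have "realizes w e ?n z ?s (B', f')"
    using realizes_mutate_along[OF sf w s(2) e _ _ r run] z by auto
  then have vals: "exchange_matrix ?s (e i) (e j) = B' ! i ! j" "w (cluster ?s (e i)) = form_value z (f' ! i)"
    if "i < ?n" "j < ?n" for i j
    using that unfolding realizes_def by auto
  have "bij_betw ((!) \<pi>) {..<?n} {..<?n}"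
  proof -
    have "inj_on ((!) \<pi>) {..<?n}" using \<pi> by (auto simp: inj_on_def nth_eq_iff_index_eq)
    moreover have "(!) \<pi> ` {..<?n} \<subseteq> {..<?n}" using \<pi> by (auto simp: subset_iff)
    ultimately show ?thesis by (simp add: bij_betw_def endo_inj_surj)
  qed
  from bij_betw_trans[OF this e] have e': "bij_betw ?e {..<?n} UNIV" by (simp add: comp_def)
  have lt: "\<pi> ! i < ?n" if "i < ?n" for i using \<pi>(2,3) that nth_mem[of i \<pi>] by fastforce
  have "form_value z (f' ! (\<pi> ! i)) = form_value (form_action ?\<rho> M z) (f ! i)" if "i < ?n" for i
  proof -
    have c: "of_int ?\<rho> * of_int (fst (f' ! (\<pi> ! i))) =
          of_int (fst (f ! i)) * of_int (fst (fst M)) + of_int (snd (f ! i)) * (of_int (fst (snd M)) :: real)"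
        "of_int ?\<rho> * of_int (snd (f' ! (\<pi> ! i))) =
          of_int (fst (f ! i)) * of_int (snd (fst M)) + of_int (snd (f ! i)) * (of_int (snd (snd M)) :: real)"
      using f'[OF that] by (metis of_int_add of_int_mult)+
    have "of_int ?\<rho> * form_value z (f' ! (\<pi> ! i)) =
        (of_int ?\<rho> * of_int (fst (f' ! (\<pi> ! i)))) * fst z + (of_int ?\<rho> * of_int (snd (f' ! (\<pi> ! i)))) * snd z"
      by (simp add: form_value_def algebra_simps)
    also have "\<dots> = of_int (fst (f ! i)) * form_value z (fst M) + of_int (snd (f ! i)) * form_value z (snd M)"
      unfolding c by (simp add: form_value_def algebra_simps)
    also have "\<dots> = of_int ?\<rho> * form_value (form_action ?\<rho> M z) (f ! i)"
    proof -
      have "of_int ?\<rho> * form_value (a / of_int ?\<rho>, b / of_int ?\<rho>) p = of_int (fst p) * a + of_int (snd p) * b"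
        for a b p
        using \<rho> by (simp add: form_value_def distrib_left)
      then show ?thesis unfolding form_action_def by simp
    qed
    finally show ?thesis using \<rho> by simp
  qed
  then have "realizes w ?e ?n (form_action ?\<rho> M z) ?s st"
    using r vals lt B' unfolding realizes_def st by simp
  then have "standard_seed P D w st (seed_of ?s) (form_action ?\<rho> M z)"
    unfolding standard_seed_def using e' mutate_along_positive_seed[OF sf w s(2)] by blast
  moreover have "(T, seed_of ?s) \<in> exchange_edges pl ^^ length ks"
    unfolding s(1) exchange_walk_seed_of by (intro exI[of _ "map e ks"]) simp
  ultimately show ?thesis by blast
qed

text \<open>
  Any relabelling preserves the exchange matrix. So it has to fix the two ends of the only double
  arrow, whose weights \<open>\<rho>\<beta>\<close> and \<open>\<rho>\<tau>\<close> determine the parameters.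
\<close>

lemma standard_seed_parameter_unique:
  assumes T: "standard_seed P D w (B, f) T z" "standard_seed P D w (B, f) T z'"
    and f: "f ! 0 = (\<rho>, 0)" "f ! 1 = (0, \<rho>)" "\<rho> > 0" and n: "2 \<le> length B"
    and arrow: "B ! 1 ! 0 = 2"
      "\<And>i j. i < length B \<Longrightarrow> j < length B \<Longrightarrow> B ! i ! j = 2 \<Longrightarrow> i = 1 \<and> j = 0"
  shows "z = z'"
proof -
  let ?n = "length B"
  obtain s e where s: "T = seed_of s" and e: "bij_betw e {..<?n} UNIV" and r: "realizes w e ?n z s (B, f)"
    using T(1) unfolding standard_seed_def by auto
  obtain s' e' where s': "T = seed_of s'" and e': "bij_betw e' {..<?n} UNIV"
    and r': "realizes w e' ?n z' s' (B, f)"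
    using T(2) unfolding standard_seed_def by auto
  obtain \<sigma> where \<sigma>: "s' = relabel \<sigma> s" using s s' self_in_seed_of[of s'] mem_seed_of by blast
  obtain i where i: "i < ?n" "e i = \<sigma> (e' 1)"
    using bij_betw_imp_surj_on[OF e] by (metis UNIV_I imageE lessThan_iff)
  obtain j where j: "j < ?n" "e j = \<sigma> (e' 0)"
    using bij_betw_imp_surj_on[OF e] by (metis UNIV_I imageE lessThan_iff)
  have n01: "0 < ?n" "1 < ?n" using n by auto
  have "exchange_matrix s (e i) (e j) = 2"
  proof -
    from n01 have "exchange_matrix s' (e' 1) (e' 0) = B ! 1 ! 0"
      using r' unfolding realizes_def fst_conv by blast
    then show ?thesis using arrow(1) i(2) j(2) by (simp add: \<sigma> relabel_def)
  qed
  then have "B ! i ! j = 2" using r i(1) j(1) unfolding realizes_def by simp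
  then have ij: "i = 1" "j = 0" using arrow(2) i(1) j(1) by blast+
  have "cluster s' (e' 1) = cluster s (e 1)" "cluster s' (e' 0) = cluster s (e 0)"
    using i j ij by (simp_all add: \<sigma> relabel_def)
  then have "form_value z (f ! 0) = form_value z' (f ! 0)" "form_value z (f ! 1) = form_value z' (f ! 1)"
    using r r' n01 unfolding realizes_def snd_conv by metis+
  then show ?thesis using f by (simp add: form_value_def prod_eq_iff)
qed

section \<open>Ping-pong\<close>

text \<open>
  The images of \<open>x\<close> under all words of length \<open>m\<close> in \<open>g\<close> and \<open>h\<close>.
\<close>

primrec ping_pong_level :: "('p \<Rightarrow> 'p) \<Rightarrow> ('p \<Rightarrow> 'p) \<Rightarrow> 'p \<Rightarrow> nat \<Rightarrow> 'p set" where
  "ping_pong_level g h x 0 = {x}"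
| "ping_pong_level g h x (Suc m) = g ` ping_pong_level g h x m \<union> h ` ping_pong_level g h x m"

text \<open>
  The outermost letter of a word can be read off from the image of \<open>x\<close>, as the images of \<open>C\<close> under \<open>g\<close>
  and \<open>h\<close> are disjoint, and it can be cancelled by injectivity. So \<open>g\<close> and \<open>h\<close> generate a free monoid
  that acts freely on the orbit of \<open>x\<close>.
\<close>

lemma ping_pong_level_card:
  assumes "x \<in> C" "g ` C \<subseteq> C" "h ` C \<subseteq> C" "inj_on g C" "inj_on h C" "g ` C \<inter> h ` C = {}"
  shows "ping_pong_level g h x m \<subseteq> C \<and> finite (ping_pong_level g h x m) \<and>
    card (ping_pong_level g h x m) = 2 ^ m"
proof (induction m)
  case (Suc m)
  let ?L = "ping_pong_level g h x m"
  have "card (g ` ?L) = card ?L" "card (h ` ?L) = card ?L"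
    using Suc assms(4,5) by (meson card_image inj_on_subset)+
  moreover have "g ` ?L \<inter> h ` ?L = {}" using Suc assms(6) by blast
  ultimately have "card (g ` ?L \<union> h ` ?L) = 2 ^ Suc m"
    using Suc by (simp add: card_Un_disjoint)
  moreover have "g ` ?L \<subseteq> C" "h ` ?L \<subseteq> C" using Suc assms(2,3) by blast+
  ultimately show ?case using Suc by simp
qed (use assms in simp)

text \<open>
  The relation \<open>N\<close> transports the free orbit from the points to the vertices of a graph: a point is
  determined by each vertex that carries it, so different points give different vertices.
\<close>

lemma ping_pong_growth:
  fixes N :: "'s \<Rightarrow> 'p \<Rightarrow> bool"
  assumes C: "x \<in> C" "g ` C \<subseteq> C" "h ` C \<subseteq> C" "inj_on g C" "inj_on h C" "g ` C \<inter> h ` C = {}"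
    and step: "\<And>T z. N T z \<Longrightarrow> z \<in> C \<Longrightarrow> \<exists>T'. (T, T') \<in> R ^^ L \<and> N T' (g z)"
      "\<And>T z. N T z \<Longrightarrow> z \<in> C \<Longrightarrow> \<exists>T'. (T, T') \<in> R ^^ L \<and> N T' (h z)"
    and uniq: "\<And>T z z'. N T z \<Longrightarrow> N T z' \<Longrightarrow> z = z'"
    and S: "N S x"
  shows "\<exists>X. finite X \<and> card X = 2 ^ m \<and> X \<subseteq> {T. (S, T) \<in> R ^^ (m * L)}"
proof -
  have reach: "\<exists>T. (S, T) \<in> R ^^ (m * L) \<and> N T z" if "z \<in> ping_pong_level g h x m" for z
    using that
  proof (induction m arbitrary: z)
    case 0
    then show ?case using S by auto
  next
    case (Suc m)
    then obtain y where y: "y \<in> ping_pong_level g h x m" "z = g y \<or> z = h y" by auto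
    then obtain T where T: "(S, T) \<in> R ^^ (m * L)" "N T y" using Suc.IH by blast
    have "y \<in> C" using ping_pong_level_card[OF C] y(1) by blast
    then obtain T' where "(T, T') \<in> R ^^ L" "N T' z" using step T(2) y(2) by blast
    then show ?case using T(1) by (auto simp: relpow_add add.commute[of L])
  qed
  then obtain t where t: "\<And>z. z \<in> ping_pong_level g h x m \<Longrightarrow> (S, t z) \<in> R ^^ (m * L) \<and> N (t z) z"
    by metis
  have "inj_on t (ping_pong_level g h x m)" using t uniq by (metis inj_onI)
  then have "card (t ` ping_pong_level g h x m) = 2 ^ m"
    using ping_pong_level_card[OF C] by (simp add: card_image)
  then show ?thesis
    using t ping_pong_level_card[OF C] by (intro exI[of _ "t ` ping_pong_level g h x m"]) auto
qed

definition positive_form :: "form \<Rightarrow> bool" where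
  "positive_form p \<longleftrightarrow> 0 \<le> fst p \<and> 0 \<le> snd p \<and> (0 < fst p \<or> 0 < snd p)"

lemma positive_form_value:
  assumes "positive_form p" "z \<in> quadrant"
  shows "0 < form_value z p"
  using assms unfolding positive_form_def form_value_def
  by (auto intro: add_pos_nonneg add_nonneg_pos)

definition positive_matrix :: "form \<times> form \<Rightarrow> bool" where
  "positive_matrix M \<longleftrightarrow> positive_form (fst M) \<and> positive_form (snd M) \<and>
     fst (fst M) * snd (snd M) \<noteq> snd (fst M) * fst (snd M)"

lemma form_action_quadrant:
  assumes "positive_matrix M" "\<rho> > 0"
  shows "form_action \<rho> M ` quadrant \<subseteq> quadrant" "inj_on (form_action \<rho> M) quadrant"
proof -
  show "form_action \<rho> M ` quadrant \<subseteq> quadrant"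
    using assms positive_form_value unfolding positive_matrix_def form_action_def by fastforce
  obtain a b c d where M: "M = ((a, b), (c, d))" by (metis prod.collapse)
  have det: "real_of_int a * d - b * c \<noteq> 0"
    using assms(1) unfolding positive_matrix_def M
    by (simp flip: of_int_mult of_int_diff)
  show "inj_on (form_action \<rho> M) quadrant"
  proof (rule inj_onI)
    fix z z' assume "form_action \<rho> M z = form_action \<rho> M z'"
    then have eq: "a * (fst z - fst z') + b * (snd z - snd z') = 0"
      "c * (fst z - fst z') + d * (snd z - snd z') = 0"
      using assms(2) unfolding form_action_def form_value_def M by (simp_all add: algebra_simps)
    have "(real_of_int a * d - b * c) * (fst z - fst z') =
        d * (a * (fst z - fst z') + b * (snd z - snd z')) - b * (c * (fst z - fst z') + d * (snd z - snd z'))"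
      "(real_of_int a * d - b * c) * (snd z - snd z') =
        a * (c * (fst z - fst z') + d * (snd z - snd z')) - c * (a * (fst z - fst z') + b * (snd z - snd z'))"
      by (simp_all add: algebra_simps)
    then show "z = z'" unfolding eq using det by (simp add: prod_eq_iff)
  qed
qed

text \<open>
  For \<open>l = (p, q)\<close>, the line \<open>q\<beta> = p\<tau>\<close> separates the images of the quadrant under \<open>M\<close> and \<open>N\<close>.
\<close>

definition separated_by :: "int \<times> int \<Rightarrow> form \<times> form \<Rightarrow> form \<times> form \<Rightarrow> bool" where
  "separated_by l M N \<longleftrightarrow> (case l of (p, q) \<Rightarrow>
     positive_form (q * fst (fst M) - p * fst (snd M), q * snd (fst M) - p * snd (snd M)) \<and>
     positive_form (p * fst (snd N) - q * fst (fst N), p * snd (snd N) - q * snd (fst N)))"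

lemma separated_by_disjoint:
  assumes "separated_by l M N" "\<rho> > 0"
  shows "form_action \<rho> M ` quadrant \<inter> form_action \<rho> N ` quadrant = {}"
proof -
  obtain p q where l: "l = (p, q)" by (cases l)
  have "q * form_value z (fst M) - p * form_value z (snd M) > 0" if "z \<in> quadrant" for z
    using positive_form_value[OF _ that, of "(q * fst (fst M) - p * fst (snd M), q * snd (fst M) - p * snd (snd M))"]
      assms(1) unfolding separated_by_def l by (simp add: form_value_def algebra_simps)
  moreover have "q * form_value z (fst N) - p * form_value z (snd N) < 0" if "z \<in> quadrant" for z
    using positive_form_value[OF _ that, of "(p * fst (snd N) - q * fst (fst N), p * snd (snd N) - q * snd (fst N))"]
      assms(1) unfolding separated_by_def l by (simp add: form_value_def algebra_simps)
  ultimately have "form_action \<rho> M z \<noteq> form_action \<rho> N z'" if "z \<in> quadrant" "z' \<in> quadrant" for z z'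
    using that assms(2) unfolding form_action_def by fastforce
  then show ?thesis by blast
qed

section \<open>Certificates for the four quivers\<close>

definition quiver_matrix :: "'a quiver \<Rightarrow> 'a list \<Rightarrow> int list list" where
  "quiver_matrix Q vs =
     map (\<lambda>u. map (\<lambda>v. int (count (arrows Q) (u, v)) - int (count (arrows Q) (v, u))) vs) vs"

text \<open>
  The two words are \<open>0 # ks\<close> and \<open>1 # ks\<close>. A mutation at \<open>b\<close> or at \<open>t\<close> gives the same quiver with the
  roles of \<open>b\<close> and \<open>t\<close> exchanged, which is why one remaining word \<open>ks\<close> and one permutation \<open>\<pi>\<close> serve
  for both.
\<close>

definition ping_pong_certificate ::
  "'a quiver \<Rightarrow> 'a list \<Rightarrow> form list \<Rightarrow> nat list \<Rightarrow> nat list \<Rightarrow>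
     form \<times> form \<Rightarrow> form \<times> form \<Rightarrow> int \<times> int \<Rightarrow> bool" where
  "ping_pong_certificate Q vs f ks \<pi> M N l \<longleftrightarrow>
     (let B = quiver_matrix Q vs; \<rho> = fst (f ! 0) in
        distinct vs \<and> set vs = vertices Q \<and> length f = length vs \<and> 2 \<le> length vs \<and>
        0 < \<rho> \<and> f ! 0 = (\<rho>, 0) \<and> f ! 1 = (0, \<rho>) \<and> B ! 1 ! 0 = 2 \<and>
        list_all (\<lambda>i. list_all (\<lambda>j. B ! i ! j = 2 \<longrightarrow> i = 1 \<and> j = 0) [0..<length vs]) [0..<length vs] \<and>
        returning_word (B, f) (0 # ks) \<pi> M \<and> returning_word (B, f) (1 # ks) \<pi> N \<and>
        positive_matrix M \<and> positive_matrix N \<and> separated_by l M N)"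

text \<open>
  An arm in a tube of rank \<open>p\<close> consists of rigid sheaves of lengths \<open>p - 1, \<dots>, 1\<close>, and a sheaf of
  length \<open>j\<close> has the form \<open>(\<rho>j/p) (\<beta> + \<tau>)\<close>. The words come from a breadth-first search through the
  seeds that are reached by symbolic mutations only. For \<open>D4_11\<close> the tail mutates all four arm
  vertices, and the two matrices are \<open>(\<beta>, \<tau>) \<mapsto> (\<beta> + 2\<tau>, \<tau>)\<close> and \<open>(\<beta>, \<tau>) \<mapsto> (\<beta>, 2\<beta> + \<tau>)\<close>.
\<close>

lemma D4_certificate:
  "ping_pong_certificate D4_11 [Vb, Vt, Vx 1, Vx 2, Vx 3, Vx 4]
     [(2, 0), (0, 2), (1, 1), (1, 1), (1, 1), (1, 1)]
     [2, 3, 4, 5] [0, 1, 2, 3, 4, 5]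
     ((2, 4), (0, 2)) ((2, 0), (4, 2)) (1, 2)"
  by code_simp

lemma E6_certificate:
  "ping_pong_certificate E6_11 [Vb, Vt, Vx 1, Vy 1, Vz 1, Vx 2, Vy 2, Vz 2]
     [(3, 0), (0, 3), (2, 2), (2, 2), (2, 2), (1, 1), (1, 1), (1, 1)]
     [2, 3, 4, 0, 5, 6, 7, 1] [4, 0, 5, 6, 1, 3, 2, 7]
     ((2, 5), (1, 7)) ((4, 1), (11, 5)) (1, 2)"
  by code_simp

lemma E7_certificate:
  "ping_pong_certificate E7_11 [Vb, Vt, Vx 1, Vy 1, Vy 2, Vy 3, Vz 1, Vz 2, Vz 3]
     [(4, 0), (0, 4), (2, 2), (3, 3), (2, 2), (1, 1), (3, 3), (2, 2), (1, 1)]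
     [2, 3, 4, 5, 0, 6, 7, 1, 3, 5, 8, 0] [3, 7, 1, 5, 6, 2, 0, 8, 4]
     ((5, 13), (3, 11)) ((11, 3), (13, 5)) (1, 1)"
  by code_simp

lemma E8_certificate:
  "ping_pong_certificate E8_11 [Vb, Vt, Vx 1, Vy 1, Vy 2, Vy 3, Vy 4, Vy 5, Vz 1, Vz 2]
     [(6, 0), (0, 6), (3, 3), (5, 5), (4, 4), (3, 3), (2, 2), (1, 1), (4, 4), (2, 2)]
     [2, 3, 4, 8, 0, 1, 5, 6, 9, 8, 0, 3, 7, 2] [6, 8, 3, 2, 7, 9, 1, 4, 0, 5]
     ((5, 17), (7, 31)) ((19, 7), (41, 17)) (1, 2)"
  by code_simp

section \<open>Exponential growth\<close>

text \<open>
  The base is \<open>2\<close> to the power \<open>1 / L\<close>; the factor \<open>c\<close> pays for the initial distance \<open>d\<close> and for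
  rounding \<open>n - d\<close> down to a multiple of \<open>L\<close>.
\<close>

lemma doubling_imp_exponential:
  fixes F :: "nat \<Rightarrow> nat"
  assumes "0 < L" and doubling: "\<And>m. 2 ^ m \<le> F (d + m * L)" and mono: "mono F" and pos: "\<And>n. 1 \<le> F n"
  shows "\<exists>c a :: real. c > 0 \<and> a > 1 \<and> (\<forall>n. c * a ^ n \<le> real (F n))"
proof (intro exI conjI allI)
  let ?a = "root L 2"
  show "1 < ?a" using \<open>0 < L\<close> by simp
  then show "0 < 1 / ?a ^ (d + L)" by simp
  fix n
  define m where "m = (n - d) div L"
  have "n - d < m * L + L"
    unfolding m_def using dividend_less_div_times[OF \<open>0 < L\<close>, of "n - d"] by simp
  then have "n \<le> d + L + m * L" by linarith
  then have "?a ^ n \<le> ?a ^ (d + L + m * L)" using \<open>1 < ?a\<close> by (intro power_increasing) auto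
  also have "\<dots> = ?a ^ (d + L) * 2 ^ m"
    using \<open>0 < L\<close> by (simp add: power_add power_mult mult.commute[of m])
  also have "(2::real) ^ m \<le> real (F n)"
  proof (cases "n < d")
    case True
    then show ?thesis using pos[of n] unfolding m_def by simp
  next
    case False
    have "m * L \<le> n - d" unfolding m_def by (simp add: mult.commute)
    then have "d + m * L \<le> n" using False by linarith
    then have "2 ^ m \<le> F n" using doubling[of m] monoD[OF mono] le_trans by blast
    then show ?thesis by (metis of_nat_le_iff of_nat_numeral of_nat_power)
  qed
  finally show "1 / ?a ^ (d + L) * ?a ^ n \<le> real (F n)"
    using \<open>1 < ?a\<close> by (simp add: field_simps)
qed

text \<open>
  Both \<open>S0\<close> and \<open>S\<close> are reached from the defining seed \<open>s\<close> of the algebra. The walk from \<open>S0\<close> to \<open>S\<close>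
  first runs back to \<open>s\<close>, and the valuation is chosen to have the standard weights at \<open>S\<close>.
\<close>

lemma quiver_seed_standard:
  fixes A :: "('v::finite, 'f::field_char_0) cluster_algebra"
  assumes A: "is_cluster_algebra P pl A" and cert: "ping_pong_certificate Q vs f ks \<pi> M N l"
    and S: "S \<in> seeds A" "t \<in> S" "has_exchange_quiver t Q" and S0: "S0 \<in> seeds A"
  obtains D w d s0 where "is_semifield P pl" "tropical_valuation P D w"
    "standard_seed P D w (quiver_matrix Q vs, f) S (1, 1)"
    "S0 = seed_of s0" "(S0, S) \<in> exchange_edges pl ^^ d"
proof -
  obtain s where sf: "is_semifield P pl" and emb: "group_ring_embeds P" and s: "is_labelled_seed P s"
    and seeds: "seeds A = {T. (seed_of s, T) \<in> (exchange_edges pl)\<^sup>*}"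
    using A unfolding is_cluster_algebra_def by blast
  have along: "\<exists>js. T = seed_of (mutate_along pl js s)" if "T \<in> seeds A" for T
    using that unfolding seeds rtrancl_power mem_Collect_eq exchange_walk_seed_of by blast
  obtain js where js: "S = seed_of (mutate_along pl js s)" using along S(1) by blast
  obtain js0 where js0: "S0 = seed_of (mutate_along pl js0 s)" using along S0 by blast
  let ?s = "mutate_along pl js s" and ?r = "mutate_along pl js0 s" and ?n = "length vs"
  have vs: "distinct vs" "set vs = vertices Q" "length f = ?n"
    using cert unfolding ping_pong_certificate_def by (simp_all add: Let_def)
  have lenB: "length (quiver_matrix Q vs) = ?n" unfolding quiver_matrix_def by simp
  \<comment> \<open>The given representative \<open>t\<close> of \<open>S\<close> need not be the one reached along \<open>js\<close>, so the labelling \<open>e\<close> absorbs the relabelling \<open>\<sigma>\<close>.\<close>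
  obtain \<sigma> where \<sigma>: "bij \<sigma>" "t = relabel \<sigma> ?s" using S(2) unfolding js mem_seed_of by blast
  obtain \<phi> where \<phi>: "bij_betw \<phi> UNIV (vertices Q)"
    "\<And>i j. exchange_matrix t i j =
      int (count (arrows Q) (\<phi> i, \<phi> j)) - int (count (arrows Q) (\<phi> j, \<phi> i))"
    using S(3) unfolding has_exchange_quiver_def by blast
  define e where "e i = \<sigma> (inv_into UNIV \<phi> (vs ! i))" for i
  have "bij_betw ((!) vs) {..<?n} (vertices Q)"
    using bij_betw_nth[OF vs(1) refl vs(2)[symmetric]] .
  then have "bij_betw (\<sigma> \<circ> (inv_into UNIV \<phi> \<circ> (!) vs)) {..<?n} UNIV"
    using bij_betw_inv_into[OF \<phi>(1)] \<sigma>(1) by (intro bij_betw_trans)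
  then have e: "bij_betw e {..<?n} UNIV" unfolding e_def[abs_def] comp_def .
  have mat: "exchange_matrix ?s (e i) (e j) = quiver_matrix Q vs ! i ! j" if "i < ?n" "j < ?n" for i j
  proof -
    have "\<phi> (inv_into UNIV \<phi> (vs ! i)) = vs ! i" if "i < ?n" for i
      using bij_betw_inv_into_right[OF \<phi>(1)] vs(2) that nth_mem by blast
    then show ?thesis
      using that \<phi>(2)[of "inv_into UNIV \<phi> (vs ! i)" "inv_into UNIV \<phi> (vs ! j)"]
      unfolding e_def \<sigma>(2) quiver_matrix_def by (simp add: relabel_def)
  qed
  obtain D w where w: "tropical_valuation P D w" and pos: "positive_seed P D s"
    and val: "\<And>i. w (cluster ?s i) = form_value (1, 1) (f ! inv_into {..<?n} e i)"
    using tropical_values_prescribed[OF sf emb s, of js "\<lambda>i. form_value (1, 1) (f ! inv_into {..<?n} e i)"]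
    by blast
  have "realizes w e ?n (1, 1) ?s (quiver_matrix Q vs, f)"
    unfolding realizes_def
    using mat val vs(3) lenB bij_betw_inv_into_left[OF e] by simp
  then have std: "standard_seed P D w (quiver_matrix Q vs, f) S (1, 1)"
    unfolding standard_seed_def fst_conv lenB
    using js e mutate_along_positive_seed[OF sf w pos] by blast
  have "mutate_along pl (rev js0 @ js) ?r = ?s"
    using mutate_along_rev[OF sf w pos] by simp
  then have "(S0, S) \<in> exchange_edges pl ^^ length (rev js0 @ js)"
    unfolding js0 exchange_walk_seed_of js by metis
  with that sf w std js0 show thesis by blast
qed

lemma ping_pong_certificate_growth:
  fixes A :: "('v::finite, 'f::field_char_0) cluster_algebra"
  assumes A: "is_cluster_algebra P pl A" and cert: "ping_pong_certificate Q vs f ks \<pi> M N l"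
    and S: "\<exists>S\<in>seeds A. \<exists>s\<in>S. has_exchange_quiver s Q" and S0: "S0 \<in> seeds A"
  shows "\<exists>c a :: real. c > 0 \<and> a > 1 \<and> (\<forall>n. c * a ^ n \<le> real (card (seeds_within pl S0 n)))"
proof -
  let ?B = "quiver_matrix Q vs" and ?\<rho> = "fst (f ! 0)" and ?L = "Suc (length ks)"
  let ?F = "\<lambda>n. card (seeds_within pl S0 n)"
  obtain S t where S: "S \<in> seeds A" "t \<in> S" "has_exchange_quiver t Q" using S by blast
  obtain D w d s0 where sf: "is_semifield P pl" and w: "tropical_valuation P D w"
    and std: "standard_seed P D w (?B, f) S (1, 1)"
    and s0: "S0 = seed_of s0" and d: "(S0, S) \<in> exchange_edges pl ^^ d"
    using quiver_seed_standard[OF A cert S S0] by metis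
  have lenB: "length ?B = length vs" unfolding quiver_matrix_def by simp
  have c: "?\<rho> > 0" "f ! 0 = (?\<rho>, 0)" "f ! 1 = (0, ?\<rho>)" "2 \<le> length ?B" "?B ! 1 ! 0 = 2"
    "\<And>i j. i < length ?B \<Longrightarrow> j < length ?B \<Longrightarrow> ?B ! i ! j = 2 \<Longrightarrow> i = 1 \<and> j = 0"
    "returning_word (?B, f) (0 # ks) \<pi> M" "returning_word (?B, f) (1 # ks) \<pi> N"
    "positive_matrix M" "positive_matrix N" "separated_by l M N"
    using cert unfolding ping_pong_certificate_def lenB by (simp_all add: Let_def list_all_iff)
  have move: "\<exists>T'. (T, T') \<in> exchange_edges pl ^^ ?L \<and> standard_seed P D w (?B, f) T' (form_action ?\<rho> K z)"
    if "standard_seed P D w (?B, f) T z" "z \<in> quadrant" "returning_word (?B, f) (i # ks) \<pi> K" for T z K i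
    using standard_seed_returning_word[OF sf w that] c(1) by simp
  have far: "\<exists>X. finite X \<and> card X = 2 ^ m \<and> X \<subseteq> {T. (S, T) \<in> exchange_edges pl ^^ (m * ?L)}" for m
  proof (rule ping_pong_growth[where C = quadrant and g = "form_action ?\<rho> M" and h = "form_action ?\<rho> N"
        and N = "standard_seed P D w (?B, f)"])
    show "(1, 1) \<in> quadrant" by simp
    show "form_action ?\<rho> M ` quadrant \<inter> form_action ?\<rho> N ` quadrant = {}"
      using separated_by_disjoint c(1,11) by blast
    show "form_action ?\<rho> M ` quadrant \<subseteq> quadrant" "inj_on (form_action ?\<rho> M) quadrant"
      using form_action_quadrant[OF c(9,1)] .
    show "form_action ?\<rho> N ` quadrant \<subseteq> quadrant" "inj_on (form_action ?\<rho> N) quadrant"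
      using form_action_quadrant[OF c(10,1)] .
    show "z = z'" if "standard_seed P D w (?B, f) T z" "standard_seed P D w (?B, f) T z'" for T z z'
      using standard_seed_parameter_unique[OF that c(2,3,1,4,5,6)] .
  qed (use std move c(7,8) in blast)+
  have fin: "finite (seeds_within pl S0 n)" for n
    unfolding s0 by (rule finite_seeds_within)
  have ball: "{T. (S, T) \<in> exchange_edges pl ^^ k} \<subseteq> seeds_within pl S0 (d + k)" for k
    unfolding seeds_within_def using d by (auto simp: relpow_add intro!: exI[of _ "d + k"])
  have "2 ^ m \<le> ?F (d + m * ?L)" for m
  proof -
    obtain X where "card X = 2 ^ m" "X \<subseteq> {T. (S, T) \<in> exchange_edges pl ^^ (m * ?L)}"
      using far by blast
    then show ?thesis using card_mono[OF fin subset_trans[OF _ ball]] by metis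
  qed
  moreover have "mono ?F"
    by (intro monoI card_mono[OF fin]) (auto simp: seeds_within_def intro: order_trans)
  moreover have "1 \<le> ?F n" for n
  proof -
    have "S0 \<in> seeds_within pl S0 n" unfolding seeds_within_def by (intro CollectI exI[of _ 0]) simp
    then show ?thesis using fin[of n] by (simp add: Suc_le_eq card_gt_0_iff) blast
  qed
  ultimately show ?thesis
    by (intro doubling_imp_exponential[of ?L ?F d]) simp_all
qed

theorem theorem1p1:
  fixes Q :: "vertex quiver"
    and P :: "'f::field_char_0 set"
    and pl :: "'f \<Rightarrow> 'f \<Rightarrow> 'f"
    and A :: "('v::finite, 'f) cluster_algebra"
    and S0 :: "('v, 'f) seed"
  assumes "Q \<in> {D4_11, E6_11, E7_11, E8_11}"
    and "is_cluster_algebra P pl A"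
    and "\<exists>S\<in>seeds A. \<exists>s\<in>S. has_exchange_quiver s Q"
    and "S0 \<in> seeds A"
  shows "\<exists>c a :: real. c > 0 \<and> a > 1 \<and>
           (\<forall>n. c * a ^ n \<le> real (card (seeds_within pl S0 n)))"
proof -
  obtain vs f ks \<pi> M N l where "ping_pong_certificate Q vs f ks \<pi> M N l"
    using assms(1) D4_certificate E6_certificate E7_certificate E8_certificate by blast
  from ping_pong_certificate_growth[OF assms(2) this assms(3,4)] show ?thesis .
qed

end
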